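(* Every general safe recursive function $f:\mathcal T(\mathcal C)^{k+l}\to\mathcal T(\mathcal C)$ can be computed by a constructor GRS $\mathcal G$ that is precedence terminating with argument separation and for which there is a constant $d\ge\max\big(\{\mathrm{ar}(g):g\in\mathcal F\}\cup\{|K{\restriction}r|:(K,l,r)\in\mathcal G_{\mathrm{fin}}\}\big)$ such that every rule $(K,l,r)\in\mathcal G_{\mathrm{inf}}$ satisfies: (i) $(K{\restriction}l)\cap\mathrm{nrm}$ is maximally shared; (ii) $K{\restriction}v$ is closed for every labeled $v\in\mathrm{nrm}(l)$; (iii) $\big|\{v\in\mathrm{nrm}(l):v\text{ unlabeled}\}\cup\bigcup_{v\in\mathrm{safe}(l)}V_{K\restriction v}\big|\le d$; (iv) $|K{\restriction}r|\le|K{\restriction}l|+\big|\bigcup_{v\in\mathrm{nrm}(r)}V_{K\restriction v}\big|$.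
   Context: General safe recursive functions. Fix a finite set $\mathcal C$ of constructors containing at least one constant, enumerated $c_1,\dots,c_{|\mathcal C|}$; $\mathcal T(\mathcal C)$ is the set of ground constructor terms. Functions carry a separation of arguments into normal and safe ones, written $f(x_1,\dots,x_k;y_1,\dots,y_l)$. The general safe recursive functions are the least class containing: constants $O^{k,l}_j(\vec x;\vec y)=c_j$ ($c_j$ a constant); constructors $C_j(;x_1,\dots,x_{\mathrm{ar}(c_j)})=c_j(x_1,\dots,x_{\mathrm{ar}(c_j)})$; projections $I^{k,l}_j(x_1,\dots,x_k;x_{k+1},\dots,x_{k+l})=x_j$; predecessors $P_{i,0}(;c_i)=c_i$ for constant $c_i$ and $P_{i,j}(;c_i(x_1,\dots,x_{\mathrm{ar}(c_i)}))=x_j$; conditional $C(;c_j(\vec x),y_1,\dots,y_{|\mathcal C|})=y_j$; and closed under safe composition $f(\vec x;\vec y)=h(x_{j_1},\dots,x_{j_m};g_1(\vec x;\vec y),\dots,g_n(\vec x;\vec y))$ with $\{j_1,\dots,j_m\}\subseteq\{1,\dots,k\}$, and general safe recursion $f(c_j(x_1,\dots,x_{\mathrm{ar}(c_j)}),\vec y;\vec z)=h_j(\vec x,\vec y;\vec z,f(x_1,\vec y;\vec z),\dots,f(x_{\mathrm{ar}(c_j)},\vec y;\vec z))$ for each constructor $c_j$ (for constants: $f(c_j,\vec y;\vec z)=h_j(\vec y;\vec z)$). Term graphs. $\mathcal F=\mathcal C\cup\mathcal D$ is a finite signature with arity $\mathrm{ar}$. A labeled graph: finite acyclic directed graph $(V_G,E_G)$,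 partial labeling $\mathrm{lab}_G:V_G\to\mathcal F$, successor function $\mathrm{att}_G:V_G\to V_G^*$ with $\mathrm{att}_G(v)$ of length $\mathrm{ar}(\mathrm{lab}_G(v))$ if $v$ is labeled and empty otherwise, its entries being exactly the $E_G$-successors of $v$. A term graph has a root $\rho_G$ from which all nodes are reachable; $\mathcal{TG}(\mathcal F)$, $\mathcal{TG}(\mathcal C)$ as usual. $G{\restriction}v$ is the sub-term graph rooted at $v$; $|G|=|V_G|$. Closed: all nodes labeled. Basic: $\mathrm{lab}_G(\rho_G)\in\mathcal D$ and $G{\restriction}v\in\mathcal{TG}(\mathcal C)$ for each successor $v$ of $\rho_G$. Each $G{\restriction}v$ has a term representation (unlabeled nodes as distinct variables); $G$ is maximally shared if distinct nodes have distinct term representations. Ground constructor terms are represented by closed term graphs over $\mathcal C$. Argument separation. Argument positions of each symbol are split into normal and safe; constructors have only safe positions; nodes with the same label have the same separation. $\mathrm{nrm}(v)$, $\mathrm{safe}(v)$ are the successors of $v$ at normal, resp. safe, positions. $H\sqsubset_{\mathrm{nrm}}G$ means $H=(G{\restriction}v){\restriction}u$ for some $v\in\mathrm{nrm}(\rho_G)$ and node $u$. For $G$ with $\mathrm{att}_G(\rho_G)=v_1,\dots,v_k;v_{k+1},\dots,v_{k+l}$, $G\cap\mathrm{nrm}$ is the term graph with root $\rho_G$ whose nodes are $\rho_G$, the nodes of $G{\restriction}v$ for $v\in\mathrm{nrm}(\rho_G)$, and $l$ fresh unlabeled nodes $u_1,\dots,u_l$, with $\mathrm{att}(\rho_G)=v_1,\dots,v_k;u_1,\dots,u_l$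 (if no safe successor of the root is labeled, $G\cap\mathrm{nrm}=G$). Rewriting. Homomorphisms preserve labels, successor sequences at labeled nodes and the normal/safe split. A graph rewrite rule $(K,l,r)$: labeled graph $K$, distinct nodes $l,r$, every unlabeled node of $K{\restriction}r$ in $K{\restriction}l$; constructor rule if $K{\restriction}l$ is basic. A GRS is a possibly infinite set of rules; a constructor GRS consists of constructor rules. The step $G\to_{\mathcal G}H$ via a rule $(K,l,r)$ and homomorphism $\varphi:K{\restriction}l\to G$ is the standard build/redirection/garbage-collection step replacing $G{\restriction}\varphi(l)$ by an instance of $K{\restriction}r$. $\mathcal D_{\mathrm{inf}}$: defined symbols labeling the left root of infinitely many rules; $\mathcal G_{\mathrm{inf}}$: rules whose left root label is in $\mathcal D_{\mathrm{inf}}$; $\mathcal G_{\mathrm{fin}}=\mathcal G\setminus\mathcal G_{\mathrm{inf}}$. A GRS computes $f$ if some defined symbol $\mathsf f$ with the same argument separation satisfies: for all inputs $\vec t$, every maximal rewrite sequence from the maximally shared closed basic term graph representing $\mathsf f(\vec t)$ is finite and ends in a closed term graph over $\mathcal C$ representing $f(\vec t)$. Precedence termination with argument separation. A precedence $\sqsubset$ is a well-founded strict partial order on $\mathcal F$ with constructors minimal. $H\sqsubset_{\mathrm{pt}}G$ holds if $\mathrm{lab}_H(v)\sqsubset\mathrm{lab}_G(\rho_G)$ for every labeled node $v$ of $H$ and either (1) $H=G{\restriction}u$ or $H\sqsubset_{\mathrm{pt}}G{\restriction}u$ for some successor $u$ of $\rho_G$; or (2) $\rho_H$ is labeled, $H{\restriction}v\sqsubset_{\mathrm{nrm}}G$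 for each $v\in\mathrm{nrm}(\rho_H)$, and $H{\restriction}v\sqsubset_{\mathrm{pt}}G$ for each $v\in\mathrm{safe}(\rho_H)$. A GRS is precedence terminating with argument separation if for some separation and precedence, $K{\restriction}r\sqsubset_{\mathrm{pt}}K{\restriction}l$ for every rule. *)

theory Defs
  imports Main
begin

datatype 'c gterm = T 'c "'c gterm list"

text \<open>The constructor set is given by an enumeration cs (c_1,...,c_|C|) and an arity function car.\<close>

fun gterm_ok :: "'c list \<Rightarrow> ('c \<Rightarrow> nat) \<Rightarrow> 'c gterm \<Rightarrow> bool" where
  "gterm_ok cs car (T c ts) = (c \<in> set cs \<and> length ts = car c \<and> (\<forall>t\<in>set ts. gterm_ok cs car t))"

definition vargs :: "'c list \<Rightarrow> ('c \<Rightarrow> nat) \<Rightarrow> nat \<Rightarrow> 'c gterm list \<Rightarrow> bool" where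
  "vargs cs car n xs \<longleftrightarrow> length xs = n \<and> (\<forall>x\<in>set xs. gterm_ok cs car x)"

text \<open>gsr cs car k l f: f (with k normal and l safe arguments, given as two lists)
  is a general safe recursive function. Equations are only required on valid inputs.
  Convention for predecessors outside their intended domain: they return their argument.\<close>

inductive gsr :: "'c list \<Rightarrow> ('c \<Rightarrow> nat) \<Rightarrow> nat \<Rightarrow> nat \<Rightarrow>
    ('c gterm list \<Rightarrow> 'c gterm list \<Rightarrow> 'c gterm) \<Rightarrow> bool"
  for cs :: "'c list" and car :: "'c \<Rightarrow> nat" where
  const: "\<lbrakk> j < length cs; car (cs ! j) = 0;
      \<forall>xs ys. vargs cs car k xs \<and> vargs cs car l ys \<longrightarrow> f xs ys = T (cs ! j) [] \<rbrakk>
    \<Longrightarrow> gsr cs car k l f"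
| cons: "\<lbrakk> j < length cs;
      \<forall>ys. vargs cs car (car (cs ! j)) ys \<longrightarrow> f [] ys = T (cs ! j) ys \<rbrakk>
    \<Longrightarrow> gsr cs car 0 (car (cs ! j)) f"
| proj: "\<lbrakk> j < k + l;
      \<forall>xs ys. vargs cs car k xs \<and> vargs cs car l ys \<longrightarrow> f xs ys = (xs @ ys) ! j \<rbrakk>
    \<Longrightarrow> gsr cs car k l f"
| pred: "\<lbrakk> i < length cs; (j = 0 \<and> car (cs ! i) = 0) \<or> (1 \<le> j \<and> j \<le> car (cs ! i));
      \<forall>ts. gterm_ok cs car (T (cs ! i) ts) \<longrightarrow>
         f [] [T (cs ! i) ts] = (if j = 0 then T (cs ! i) ts else ts ! (j - 1));
      \<forall>c ts. gterm_ok cs car (T c ts) \<and> c \<noteq> cs ! i \<longrightarrow> f [] [T c ts] = T c ts \<rbrakk>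
    \<Longrightarrow> gsr cs car 0 1 f"
| cond: "\<lbrakk> \<forall>j ts zs. j < length cs \<and> gterm_ok cs car (T (cs ! j) ts) \<and> vargs cs car (length cs) zs
         \<longrightarrow> f [] (T (cs ! j) ts # zs) = zs ! j \<rbrakk>
    \<Longrightarrow> gsr cs car 0 (Suc (length cs)) f"
| comp: "\<lbrakk> gsr cs car (length js) (length gs) h; \<forall>g\<in>set gs. gsr cs car k l g;
      \<forall>j\<in>set js. j < k;
      \<forall>xs ys. vargs cs car k xs \<and> vargs cs car l ys \<longrightarrow>
         f xs ys = h (map (\<lambda>j. xs ! j) js) (map (\<lambda>g. g xs ys) gs) \<rbrakk>
    \<Longrightarrow> gsr cs car k l f"
| recur: "\<lbrakk> length hs = length cs;
      \<forall>j < length cs. gsr cs car (car (cs ! j) + k) (l + car (cs ! j)) (hs ! j);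
      \<forall>j xs ys zs. j < length cs \<and> vargs cs car (car (cs ! j)) xs \<and> vargs cs car k ys \<and> vargs cs car l zs
         \<longrightarrow> f (T (cs ! j) xs # ys) zs = (hs ! j) (xs @ ys) (zs @ map (\<lambda>x. f (x # ys) zs) xs) \<rbrakk>
    \<Longrightarrow> gsr cs car (Suc k) l f"

datatype 'c sym = Con 'c | Fn nat

text \<open>A signature: constructors cs with arities car, defined symbols dfs (names are naturals)
  with arities dar; the first dnrm f argument positions of f are normal, the rest safe.\<close>

record 'c sig =
  cons :: "'c list"
  car :: "'c \<Rightarrow> nat"
  dfs :: "nat set"
  dar :: "nat \<Rightarrow> nat"
  dnrm :: "nat \<Rightarrow> nat"

fun sar :: "'c sig \<Rightarrow> 'c sym \<Rightarrow> nat" where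
  "sar S (Con c) = car S c"
| "sar S (Fn f) = dar S f"

fun snn :: "'c sig \<Rightarrow> 'c sym \<Rightarrow> nat" where
  "snn S (Con c) = 0"
| "snn S (Fn f) = dnrm S f"

definition Fsyms :: "'c sig \<Rightarrow> 'c sym set" where
  "Fsyms S = Con ` set (cons S) \<union> Fn ` dfs S"

definition sig_ok :: "'c sig \<Rightarrow> bool" where
  "sig_ok S \<longleftrightarrow> finite (dfs S) \<and> (\<forall>f\<in>dfs S. dnrm S f \<le> dar S f)"

record 'f lgraph =
  nodes :: "nat set"
  lab :: "nat \<Rightarrow> 'f option"
  att :: "nat \<Rightarrow> nat list"

record 'f tgraph =
  gr :: "'f lgraph"
  root :: nat

definition edges :: "'f lgraph \<Rightarrow> (nat \<times> nat) set" where
  "edges g = {(v, u). v \<in> nodes g \<and> u \<in> set (att g v)}"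

definition reach :: "'f lgraph \<Rightarrow> nat \<Rightarrow> nat set" where
  "reach g v = {u. (v, u) \<in> (edges g)\<^sup>*}"

definition lgraph_ok :: "'c sig \<Rightarrow> 'c sym lgraph \<Rightarrow> bool" where
  "lgraph_ok S g \<longleftrightarrow> finite (nodes g) \<and> acyclic (edges g)
     \<and> (\<forall>v\<in>nodes g. set (att g v) \<subseteq> nodes g
          \<and> length (att g v) = (case lab g v of None \<Rightarrow> 0 | Some a \<Rightarrow> sar S a)
          \<and> (\<forall>a. lab g v = Some a \<longrightarrow> a \<in> Fsyms S))
     \<and> (\<forall>v. v \<notin> nodes g \<longrightarrow> lab g v = None \<and> att g v = [])"

definition tgraph_ok :: "'c sig \<Rightarrow> 'c sym tgraph \<Rightarrow> bool" where
  "tgraph_ok S G \<longleftrightarrow> lgraph_ok S (gr G) \<and> root G \<in> nodes (gr G) \<and> nodes (gr G) = reach (gr G) (root G)"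

definition restr :: "'f lgraph \<Rightarrow> nat \<Rightarrow> 'f tgraph" where
  "restr g v = \<lparr> gr = \<lparr> nodes = reach g v,
       lab = (\<lambda>n. if n \<in> reach g v then lab g n else None),
       att = (\<lambda>n. if n \<in> reach g v then att g n else []) \<rparr>, root = v \<rparr>"

definition sub :: "'f tgraph \<Rightarrow> nat \<Rightarrow> 'f tgraph" where
  "sub G v = restr (gr G) v"

definition gsize :: "'f tgraph \<Rightarrow> nat" where
  "gsize G = card (nodes (gr G))"

definition closed :: "'f tgraph \<Rightarrow> bool" where
  "closed G \<longleftrightarrow> (\<forall>v\<in>nodes (gr G). lab (gr G) v \<noteq> None)"

definition over_C :: "'c sig \<Rightarrow> 'c sym tgraph \<Rightarrow> bool" where
  "over_C S G \<longleftrightarrow> (\<forall>v\<in>nodes (gr G). \<forall>a. lab (gr G) v = Some a \<longrightarrow> a \<in> Con ` set (cons S))"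

definition nrm :: "'c sig \<Rightarrow> 'c sym lgraph \<Rightarrow> nat \<Rightarrow> nat list" where
  "nrm S g v = (case lab g v of None \<Rightarrow> [] | Some a \<Rightarrow> take (snn S a) (att g v))"

definition safe :: "'c sig \<Rightarrow> 'c sym lgraph \<Rightarrow> nat \<Rightarrow> nat list" where
  "safe S g v = (case lab g v of None \<Rightarrow> [] | Some a \<Rightarrow> drop (snn S a) (att g v))"

definition basic :: "'c sig \<Rightarrow> 'c sym tgraph \<Rightarrow> bool" where
  "basic S G \<longleftrightarrow> (\<exists>f\<in>dfs S. lab (gr G) (root G) = Some (Fn f))
     \<and> (\<forall>v\<in>set (att (gr G) (root G)). over_C S (sub G v))"

datatype 'f tm = Var nat | App 'f "'f tm list"

inductive repr :: "'f lgraph \<Rightarrow> nat \<Rightarrow> 'f tm \<Rightarrow> bool" for g where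
  rvar: "\<lbrakk> v \<in> nodes g; lab g v = None \<rbrakk> \<Longrightarrow> repr g v (Var v)"
| rapp: "\<lbrakk> v \<in> nodes g; lab g v = Some a; list_all2 (repr g) (att g v) ts \<rbrakk> \<Longrightarrow> repr g v (App a ts)"

definition max_shared :: "'f tgraph \<Rightarrow> bool" where
  "max_shared G \<longleftrightarrow> (\<forall>u\<in>nodes (gr G). \<forall>w\<in>nodes (gr G). \<forall>t.
      repr (gr G) u t \<and> repr (gr G) w t \<longrightarrow> u = w)"

fun emb :: "'c gterm \<Rightarrow> 'c sym tm" where
  "emb (T c ts) = App (Con c) (map emb ts)"

record 'f rule =
  rg :: "'f lgraph"
  lhs :: nat
  rhs :: nat

definition rule_ok :: "'c sig \<Rightarrow> 'c sym rule \<Rightarrow> bool" where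
  "rule_ok S R \<longleftrightarrow> lgraph_ok S (rg R) \<and> lhs R \<in> nodes (rg R) \<and> rhs R \<in> nodes (rg R)
     \<and> lhs R \<noteq> rhs R
     \<and> (\<forall>v\<in>reach (rg R) (rhs R). lab (rg R) v = None \<longrightarrow> v \<in> reach (rg R) (lhs R))"

definition lhsG :: "'f rule \<Rightarrow> 'f tgraph" where
  "lhsG R = restr (rg R) (lhs R)"

definition rhsG :: "'f rule \<Rightarrow> 'f tgraph" where
  "rhsG R = restr (rg R) (rhs R)"

definition constructor_grs :: "'c sig \<Rightarrow> 'c sym rule set \<Rightarrow> bool" where
  "constructor_grs S Gs \<longleftrightarrow> (\<forall>R\<in>Gs. rule_ok S R \<and> basic S (lhsG R))"

definition Dinf :: "'f rule set \<Rightarrow> 'f set" where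
  "Dinf Gs = {a. infinite {R\<in>Gs. lab (rg R) (lhs R) = Some a}}"

definition Ginf :: "'f rule set \<Rightarrow> 'f rule set" where
  "Ginf Gs = {R\<in>Gs. \<exists>a\<in>Dinf Gs. lab (rg R) (lhs R) = Some a}"

definition Gfin :: "'f rule set \<Rightarrow> 'f rule set" where
  "Gfin Gs = Gs - Ginf Gs"

definition hom :: "'f tgraph \<Rightarrow> 'f lgraph \<Rightarrow> (nat \<Rightarrow> nat) \<Rightarrow> bool" where
  "hom H g \<phi> \<longleftrightarrow> \<phi> ` nodes (gr H) \<subseteq> nodes g
     \<and> (\<forall>u\<in>nodes (gr H). lab (gr H) u \<noteq> None \<longrightarrow>
          lab g (\<phi> u) = lab (gr H) u \<and> att g (\<phi> u) = map \<phi> (att (gr H) u))"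

text \<open>Result of a rewrite step: build (fresh copies via psi of the nodes of K restricted to r that are
  not in K restricted to l; shared nodes mapped by phi), redirection of phi(l) to psi(r),
  garbage collection (restriction to nodes reachable from the new root).\<close>
definition step_result :: "'f rule \<Rightarrow> 'f tgraph \<Rightarrow> (nat \<Rightarrow> nat) \<Rightarrow> 'f tgraph" where
  "step_result R G \<psi> = (let K = rg R; l = lhs R; r = rhs R;
      A = reach K r - reach K l; g = gr G;
      labB = (\<lambda>n. if n \<in> nodes g then lab g n
                  else if n \<in> \<psi> ` A then lab K (the_inv_into A \<psi> n) else None);
      attB = (\<lambda>n. if n \<in> nodes g then att g n
                  else if n \<in> \<psi> ` A then map \<psi> (att K (the_inv_into A \<psi> n)) else []);
      red = (\<lambda>n. if n = \<psi> l then \<psi> r else n);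
      g' = \<lparr> nodes = nodes g \<union> \<psi> ` A, lab = labB, att = (\<lambda>n. map red (attB n)) \<rparr>
    in restr g' (red (root G)))"

definition rstep :: "'f rule set \<Rightarrow> 'f tgraph \<Rightarrow> 'f tgraph \<Rightarrow> bool" where
  "rstep Gs G H \<longleftrightarrow> (\<exists>R\<in>Gs. \<exists>\<psi>.
      hom (lhsG R) (gr G) \<psi>
      \<and> inj_on \<psi> (reach (rg R) (rhs R) - reach (rg R) (lhs R))
      \<and> \<psi> ` (reach (rg R) (rhs R) - reach (rg R) (lhs R)) \<inter> nodes (gr G) = {}
      \<and> H = step_result R G \<psi>)"

definition computes :: "'c sig \<Rightarrow> 'c sym rule set \<Rightarrow> nat \<Rightarrow> nat \<Rightarrow>
    ('c gterm list \<Rightarrow> 'c gterm list \<Rightarrow> 'c gterm) \<Rightarrow> bool" where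
  "computes S Gs k l f \<longleftrightarrow> (\<exists>fs\<in>dfs S. dar S fs = k + l \<and> dnrm S fs = k \<and>
     (\<forall>xs ys G. vargs (cons S) (car S) k xs \<and> vargs (cons S) (car S) l ys
        \<and> tgraph_ok S G \<and> closed G \<and> basic S G \<and> max_shared G
        \<and> repr (gr G) (root G) (App (Fn fs) (map emb (xs @ ys))) \<longrightarrow>
          \<not> (\<exists>s. s 0 = G \<and> (\<forall>i. rstep Gs (s i) (s (Suc i))))
        \<and> (\<forall>H. (rstep Gs)\<^sup>*\<^sup>* G H \<and> \<not> (\<exists>H'. rstep Gs H H') \<longrightarrow>
             closed H \<and> over_C S H \<and> repr (gr H) (root H) (emb (f xs ys)))))"

definition precedence :: "'c sym rel \<Rightarrow> bool" where
  "precedence P \<longleftrightarrow> wf P \<and> trans P \<and> (\<forall>a c. (a, Con c) \<notin> P)"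

definition nrm_sub :: "'c sig \<Rightarrow> 'c sym tgraph \<Rightarrow> 'c sym tgraph \<Rightarrow> bool" where
  "nrm_sub S H G \<longleftrightarrow> (\<exists>v\<in>set (nrm S (gr G) (root G)). \<exists>u\<in>nodes (gr (sub G v)). H = sub (sub G v) u)"

inductive pt :: "'c sig \<Rightarrow> 'c sym rel \<Rightarrow> 'c sym tgraph \<Rightarrow> 'c sym tgraph \<Rightarrow> bool" for S P where
  pt1: "\<lbrakk> \<forall>v\<in>nodes (gr H). \<forall>a. lab (gr H) v = Some a \<longrightarrow> (\<exists>b. lab (gr G) (root G) = Some b \<and> (a, b) \<in> P);
      u \<in> set (att (gr G) (root G)); H = sub G u \<or> pt S P H (sub G u) \<rbrakk> \<Longrightarrow> pt S P H G"
| pt2: "\<lbrakk> \<forall>v\<in>nodes (gr H). \<forall>a. lab (gr H) v = Some a \<longrightarrow> (\<exists>b. lab (gr G) (root G) = Some b \<and> (a, b) \<in> P);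
      lab (gr H) (root H) \<noteq> None;
      \<forall>v\<in>set (nrm S (gr H) (root H)). nrm_sub S (sub H v) G;
      \<forall>v\<in>set (safe S (gr H) (root H)). pt S P (sub H v) G \<rbrakk> \<Longrightarrow> pt S P H G"

definition pt_sep :: "'c sig \<Rightarrow> 'c sym rule set \<Rightarrow> bool" where
  "pt_sep S Gs \<longleftrightarrow> (\<exists>P. precedence P \<and> (\<forall>R\<in>Gs. pt S P (rhsG R) (lhsG R)))"

definition cap_nrm :: "'c sig \<Rightarrow> 'c sym tgraph \<Rightarrow> 'c sym tgraph" where
  "cap_nrm S G = (let g = gr G; \<rho> = root G; ns = nrm S g \<rho>; ss = safe S g \<rho>;
      N = (\<Union>v\<in>set ns. reach g v); m = Suc (Max (nodes g)); fr = [m..<m + length ss]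
    in if (\<forall>v\<in>set ss. lab g v = None) then G
       else \<lparr> gr = \<lparr> nodes = {\<rho>} \<union> N \<union> set fr,
                   lab = (\<lambda>n. if n = \<rho> then lab g \<rho> else if n \<in> N then lab g n else None),
                   att = (\<lambda>n. if n = \<rho> then ns @ fr else if n \<in> N then att g n else []) \<rparr>,
              root = \<rho> \<rparr>)"

definition inf_rule_conds :: "'c sig \<Rightarrow> nat \<Rightarrow> 'c sym rule \<Rightarrow> bool" where
  "inf_rule_conds S d R \<longleftrightarrow> (let K = rg R; l = lhs R; r = rhs R in
      max_shared (cap_nrm S (restr K l))
    \<and> (\<forall>v\<in>set (nrm S K l). lab K v \<noteq> None \<longrightarrow> closed (restr K v))
    \<and> card ({v\<in>set (nrm S K l). lab K v = None} \<union> (\<Union>v\<in>set (safe S K l). reach K v)) \<le> d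
    \<and> gsize (restr K r) \<le> gsize (restr K l) + card (\<Union>v\<in>set (nrm S K r). reach K v))"

end

theory Submission
  imports Defs "HOL-Library.Multiset"
begin

text \<open>
  A derivation of \<open>f\<close> is turned into a program: a list of function symbols, each defined from earlier ones.
  Only recursion needs infinitely many rules. The rule for the recursion argument \<open>t\<close> rewrites
  \<open>f(t, ys; zs)\<close> in one step to the complete unfolding of the recursion along the maximally shared graph
  of \<open>t\<close>, with one \<open>h\<close>-node for each distinct subterm of \<open>t\<close>. The right-hand side mentions only earlier
  symbols, and its normal arguments are subterms of normal arguments of the left-hand side. Its nodes are
  the \<open>h\<close>-nodes, proper subterms of \<open>t\<close> (all below its normal arguments) and variables, which gives the
  size bound (iv).

  Along a rewrite sequence all normal arguments stay inside the input graph, which is maximally shared,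
  so some recursion rule always matches at an innermost redex. Each step replaces a symbol by earlier ones,
  hence the multiset of indices of defined symbols decreases, and it preserves a valuation of the nodes
  by ground terms.
\<close>

section \<open>Terms as maximally shared graphs\<close>

text \<open>The usual recursion equations keep \<open>f\<close> on the right, whereas both clauses
  of \<open>pt\<close> demand that every label on the right lie strictly below the left root. The
  recursive call must therefore disappear from the rule, which is what forces one rule per ground
  argument. As a tree the unfolding can be exponentially larger than the shared argument. All rule
  graphs are therefore generated from terms, with the set of subterms as the set of nodes: equal
  subterms coincide automatically, and maximal sharing, acyclicity and size become facts about
  finite sets of terms. The price is paid in matching. A shared left-hand side requires equal
  subterms of the redex to be one node, and rewriting does not keep whole graphs maximally shared,
  since equal results may be built twice at safe positions. Only recursion rules need sharing, and
  they inspect a normal position; case distinctions inspect a safe argument, but only one level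
  deep. Matches need not be injective, so that the redex root differs from the other matched nodes
  has to come from acyclicity, here a rank. Termination counts nodes, not occurrences, because a
  shared redex is contracted once.\<close>

fun subt :: "'f tm \<Rightarrow> 'f tm set" where
  "subt (Var x) = {Var x}"
| "subt (App a ts) = insert (App a ts) (\<Union>t\<in>set ts. subt t)"

fun tlab :: "'f tm \<Rightarrow> 'f option" where
  "tlab (Var x) = None"
| "tlab (App a ts) = Some a"

fun targs :: "'f tm \<Rightarrow> 'f tm list" where
  "targs (Var x) = []"
| "targs (App a ts) = ts"

fun wft :: "'c sig \<Rightarrow> 'c sym tm \<Rightarrow> bool" where
  "wft S (Var x) = True"
| "wft S (App a ts) = (a \<in> Fsyms S \<and> length ts = sar S a \<and> (\<forall>t\<in>set ts. wft S t))"

lemma subt_refl [simp]: "t \<in> subt t"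
  by (cases t) auto

lemma subt_appI: "t \<in> set ts \<Longrightarrow> s \<in> subt t \<Longrightarrow> s \<in> subt (App a ts)"
  by auto

lemma arg_subt: "t \<in> set ts \<Longrightarrow> t \<in> subt (App a ts)"
  by (rule subt_appI[OF _ subt_refl])

lemma finite_subt [simp]: "finite (subt t)"
  by (induction t) auto

lemma subt_trans: "s \<in> subt t \<Longrightarrow> subt s \<subseteq> subt t"
proof (induction t)
  case (App a ts)
  show ?case
  proof (cases "s = App a ts")
    case False
    then obtain u where "u \<in> set ts" "s \<in> subt u" using App.prems by auto
    then show ?thesis using App.IH by auto
  qed simp
qed simp

lemma targs_subt: "s \<in> set (targs t) \<Longrightarrow> s \<in> subt t"
  by (cases t) (auto simp del: subt.simps intro: arg_subt)

lemma size_arg: "t \<in> set ts \<Longrightarrow> size t < size (App a ts)"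
  by (simp add: less_Suc_eq_le size_list_estimation')

lemma targs_size: "s \<in> set (targs t) \<Longrightarrow> size s < size t"
  by (cases t) (auto dest: size_arg simp del: tm.size)

lemma wft_subt: "wft S t \<Longrightarrow> s \<in> subt t \<Longrightarrow> wft S s"
  by (induction t) auto

text \<open>The injection \<open>e\<close> only turns terms into the natural numbers that serve as
  nodes; the graph proper has the terms of \<open>W\<close> as nodes and their argument lists as
  successors.\<close>

definition tgr :: "('f tm \<Rightarrow> nat) \<Rightarrow> 'f tm set \<Rightarrow> 'f lgraph" where
  "tgr e W = \<lparr> nodes = e ` W,
     lab = (\<lambda>n. if n \<in> e ` W then tlab (inv_into W e n) else None),
     att = (\<lambda>n. if n \<in> e ` W then map e (targs (inv_into W e n)) else []) \<rparr>"

definition tgt :: "('f tm \<Rightarrow> nat) \<Rightarrow> 'f tm \<Rightarrow> 'f tgraph" where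
  "tgt e t = \<lparr> gr = tgr e (subt t), root = e t \<rparr>"

definition tm_closed :: "'f tm set \<Rightarrow> bool" where
  "tm_closed W \<longleftrightarrow> (\<forall>t\<in>W. subt t \<subseteq> W)"

lemma tm_closed_subt [simp]: "tm_closed (subt t)"
  by (auto simp: tm_closed_def dest: subt_trans)

lemma tm_closed_Un: "tm_closed V \<Longrightarrow> tm_closed W \<Longrightarrow> tm_closed (V \<union> W)"
  by (auto simp: tm_closed_def)

lemma tm_closed_args: "tm_closed W \<Longrightarrow> App a ts \<in> W \<Longrightarrow> set ts \<subseteq> W"
proof
  fix t assume "tm_closed W" "App a ts \<in> W" "t \<in> set ts"
  then have "subt (App a ts) \<subseteq> W" by (simp only: tm_closed_def)
  then show "t \<in> W" using arg_subt[OF \<open>t \<in> set ts\<close>] by (rule subsetD)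
qed

lemma nodes_tgr [simp]: "nodes (tgr e W) = e ` W"
  by (simp add: tgr_def)

lemma lab_tgr [simp]: "inj_on e W \<Longrightarrow> t \<in> W \<Longrightarrow> lab (tgr e W) (e t) = tlab t"
  by (simp add: tgr_def)

lemma att_tgr [simp]: "inj_on e W \<Longrightarrow> t \<in> W \<Longrightarrow> att (tgr e W) (e t) = map e (targs t)"
  by (simp add: tgr_def)

lemma lab_tgr_outside: "n \<notin> e ` W \<Longrightarrow> lab (tgr e W) n = None"
  by (simp add: tgr_def)

lemma att_tgr_outside: "n \<notin> e ` W \<Longrightarrow> att (tgr e W) n = []"
  by (simp add: tgr_def)

lemma lgraph_eqI:
  "nodes g = nodes h \<Longrightarrow> (\<And>n. lab g n = lab h n) \<Longrightarrow> (\<And>n. att g n = att h n) \<Longrightarrow>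
    (g :: 'f lgraph) = h"
  by (auto intro!: lgraph.equality)

lemma reach_closed:
  assumes "v \<in> V" and "\<And>w. w \<in> V \<Longrightarrow> w \<in> nodes g \<Longrightarrow> set (att g w) \<subseteq> V"
  shows "reach g v \<subseteq> V"
proof
  fix u assume "u \<in> reach g v"
  then have "(v, u) \<in> (edges g)\<^sup>*" by (simp add: reach_def)
  then show "u \<in> V"
    by induction (use assms in \<open>auto simp: edges_def\<close>)
qed

lemma reach_tgr:
  assumes inj: "inj_on e W" and cl: "tm_closed W" and t: "t \<in> W"
  shows "reach (tgr e W) (e t) = e ` subt t"
proof
  show "reach (tgr e W) (e t) \<subseteq> e ` subt t"
  proof (rule reach_closed)
    fix w assume "w \<in> e ` subt t"
    then obtain s where s: "s \<in> subt t" "w = e s" by auto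
    then have "s \<in> W" using cl t by (auto simp: tm_closed_def)
    then show "set (att (tgr e W) w) \<subseteq> e ` subt t"
      using s inj by (auto dest: targs_subt subt_trans)
  qed simp
next
  have "e s \<in> reach (tgr e W) (e t)" if "s \<in> subt t" for s
    using that t
  proof (induction t)
    case (App a ts)
    show ?case
    proof (cases "s = App a ts")
      case False
      then obtain u where u: "u \<in> set ts" "s \<in> subt u" using App.prems by auto
      then have uW: "u \<in> W"
        using cl App.prems(2) subt_refl by (fastforce simp: tm_closed_def)
      then have "(e u, e s) \<in> (edges (tgr e W))\<^sup>*"
        using App.IH u by (simp add: reach_def)
      moreover have "(e (App a ts), e u) \<in> edges (tgr e W)"
        using u App.prems(2) inj by (auto simp: edges_def)
      ultimately show ?thesis by (simp add: reach_def)
    qed (simp add: reach_def)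
  qed (simp add: reach_def)
  then show "e ` subt t \<subseteq> reach (tgr e W) (e t)" by auto
qed

lemma restr_tgr:
  assumes "inj_on e W" and "tm_closed W" and "t \<in> W"
  shows "restr (tgr e W) (e t) = tgt e t"
proof -
  have sub: "subt t \<subseteq> W" using assms by (auto simp: tm_closed_def)
  then have inj: "inj_on e (subt t)" using assms(1) inj_on_subset by blast
  have "gr (restr (tgr e W) (e t)) = gr (tgt e t)"
  proof (rule lgraph_eqI)
    show "nodes (gr (restr (tgr e W) (e t))) = nodes (gr (tgt e t))"
      using assms by (simp add: restr_def tgt_def reach_tgr)
  next
    fix n
    show "lab (gr (restr (tgr e W) (e t))) n = lab (gr (tgt e t)) n"
      using assms sub inj
      by (cases "n \<in> e ` subt t") (auto simp: restr_def tgt_def reach_tgr lab_tgr_outside subset_iff)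
    show "att (gr (restr (tgr e W) (e t))) n = att (gr (tgt e t)) n"
      using assms sub inj
      by (cases "n \<in> e ` subt t") (auto simp: restr_def tgt_def reach_tgr att_tgr_outside subset_iff)
  qed
  then show ?thesis by (simp add: restr_def tgt_def)
qed

lemma root_tgt [simp]: "root (tgt e t) = e t"
  by (simp add: tgt_def)

lemma nodes_tgt [simp]: "nodes (gr (tgt e t)) = e ` subt t"
  by (simp add: tgt_def)

lemma lab_tgt [simp]: "inj_on e (subt t) \<Longrightarrow> s \<in> subt t \<Longrightarrow> lab (gr (tgt e t)) (e s) = tlab s"
  by (simp add: tgt_def)

lemma att_tgt [simp]:
  "inj_on e (subt t) \<Longrightarrow> s \<in> subt t \<Longrightarrow> att (gr (tgt e t)) (e s) = map e (targs s)"
  by (simp add: tgt_def)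

lemma sub_tgt: "inj_on e (subt t) \<Longrightarrow> s \<in> subt t \<Longrightarrow> sub (tgt e t) (e s) = tgt e s"
  by (simp add: sub_def restr_tgr tgt_def[of e t])

text \<open>This is the term that \<open>repr\<close> assigns to the node \<open>e t\<close>: an
  unlabeled node is represented by the variable carrying its own node number.\<close>

fun rename :: "('f tm \<Rightarrow> nat) \<Rightarrow> 'f tm \<Rightarrow> 'f tm" where
  "rename e (Var x) = Var (e (Var x))"
| "rename e (App a ts) = App a (map (rename e) ts)"

lemma repr_tgr_rename:
  assumes "repr (tgr e W) n s" and "inj_on e W" and "tm_closed W"
  shows "t \<in> W \<Longrightarrow> n = e t \<Longrightarrow> s = rename e t"
  using assms(1)
proof (induction arbitrary: t rule: repr.induct)
  case (rvar v)
  then show ?case using assms(2) by (cases t) auto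
next
  case (rapp v a ts)
  then obtain us where t: "t = App a us"
    using assms(2) by (cases t) auto
  have "set us \<subseteq> W" using tm_closed_args[OF assms(3)] rapp.prems(1) t by simp
  moreover have "list_all2 (\<lambda>x s. repr (tgr e W) x s \<and> (\<forall>t. t \<in> W \<longrightarrow> x = e t \<longrightarrow> s = rename e t)) (map e us) ts"
    using rapp assms(2) t by simp
  ultimately have "ts = map (rename e) us"
    by (auto simp: list_all2_conv_all_nth subset_iff intro!: nth_equalityI)
  then show ?case by (simp add: t)
qed

lemma rename_inj:
  assumes "inj_on e W" and "tm_closed W"
  shows "s \<in> W \<Longrightarrow> t \<in> W \<Longrightarrow> rename e s = rename e t \<Longrightarrow> s = t"
proof (induction s arbitrary: t)
  case (Var x)
  then show ?case using assms(1) by (cases t) (auto dest: inj_onD)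
next
  case (App a ss)
  then obtain ts where t: "t = App a ts" and eq: "map (rename e) ss = map (rename e) ts"
    by (cases t) auto
  have "set ss \<subseteq> W" "set ts \<subseteq> W"
    using tm_closed_args[OF assms(2)] App.prems(1,2) t by simp_all
  moreover have "length ss = length ts" using eq map_eq_imp_length_eq by blast
  moreover have "rename e (ss ! i) = rename e (ts ! i)" if "i < length ss" for i
    using eq that calculation(3) by (metis nth_map)
  ultimately have "ss = ts"
    using App.IH by (intro nth_equalityI) (simp_all add: subset_iff)
  then show ?case by (simp add: t)
qed

text \<open>Distinct nodes stand for distinct subterms, and passing to represented terms only
  renames variables injectively.\<close>

lemma max_shared_tgt:
  assumes "inj_on e (subt t)"
  shows "max_shared (tgt e t)"
  unfolding max_shared_def
proof (intro ballI allI impI)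
  fix u w s
  assume "u \<in> nodes (gr (tgt e t))" "w \<in> nodes (gr (tgt e t))"
    and r: "repr (gr (tgt e t)) u s \<and> repr (gr (tgt e t)) w s"
  then obtain a b where ab: "a \<in> subt t" "u = e a" "b \<in> subt t" "w = e b" by auto
  have "s = rename e a" "s = rename e b"
    using r ab repr_tgr_rename[OF _ assms tm_closed_subt] by (auto simp: tgt_def)
  then show "u = w"
    using rename_inj[OF assms tm_closed_subt] ab by auto
qed

lemma lgraph_ok_tgr:
  assumes inj: "inj_on e W" and cl: "tm_closed W" and fin: "finite W"
    and wf: "\<And>t. t \<in> W \<Longrightarrow> wft S t"
  shows "lgraph_ok S (tgr e W)"
proof -
  have args: "set (targs t) \<subseteq> W" if "t \<in> W" for t
    using cl that targs_subt by (fastforce simp: tm_closed_def)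
  \<comment> \<open>Every edge leads from a term to one of its arguments, so term size decreases
    along edges.\<close>
  have "(edges (tgr e W))\<inverse> \<subseteq> measure (\<lambda>n. size (inv_into W e n))"
    using inj args by (auto simp: edges_def targs_size subset_iff)
  then have "acyclic ((edges (tgr e W))\<inverse>)"
    using wf_acyclic wf_subset wf_measure by blast
  then have "acyclic (edges (tgr e W))" by simp
  moreover have "length (att (tgr e W) v) = (case lab (tgr e W) v of None \<Rightarrow> 0 | Some a \<Rightarrow> sar S a)
     \<and> set (att (tgr e W) v) \<subseteq> e ` W \<and> (\<forall>a. lab (tgr e W) v = Some a \<longrightarrow> a \<in> Fsyms S)" if "v \<in> e ` W" for v
  proof -
    from that obtain t where t: "t \<in> W" "v = e t" by auto
    then show ?thesis using inj wf[OF t(1)] args[OF t(1)] by (cases t) auto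
  qed
  ultimately show ?thesis
    using fin by (auto simp: lgraph_ok_def lab_tgr_outside att_tgr_outside)
qed

section \<open>Rules given by pairs of terms\<close>

text \<open>One injection serves both sides, so a subterm common to \<open>L\<close> and
  \<open>R\<close> is a single node of the rule graph. A step reuses the matched node for it and
  builds copies only for \<open>subt R - subt L\<close>.\<close>

definition rule_enc :: "'f tm \<Rightarrow> 'f tm \<Rightarrow> 'f tm \<Rightarrow> nat" where
  "rule_enc L R = (SOME e. inj_on e (subt L \<union> subt R))"

definition tm_rule :: "'f tm \<Rightarrow> 'f tm \<Rightarrow> 'f rule" where
  "tm_rule L R = \<lparr> rg = tgr (rule_enc L R) (subt L \<union> subt R),
     lhs = rule_enc L R L, rhs = rule_enc L R R \<rparr>"

lemma rule_enc_inj: "inj_on (rule_enc L R) (subt L \<union> subt R)"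
proof -
  have "\<exists>e :: _ \<Rightarrow> nat. inj_on e (subt L \<union> subt R)"
    using finite_imp_inj_to_nat_seg[of "subt L \<union> subt R"] by auto
  then show ?thesis unfolding rule_enc_def by (rule someI_ex)
qed

lemma rule_enc_inj_lhs: "inj_on (rule_enc L R) (subt L)"
  using rule_enc_inj inj_on_subset by blast

lemma rule_enc_inj_rhs: "inj_on (rule_enc L R) (subt R)"
  using rule_enc_inj inj_on_subset by blast

lemma rule_tm_closed: "tm_closed (subt L \<union> subt R)"
  by (simp add: tm_closed_Un)

lemma restr_tm_rule:
  "t \<in> subt L \<union> subt R \<Longrightarrow> restr (rg (tm_rule L R)) (rule_enc L R t) = tgt (rule_enc L R) t"
  unfolding tm_rule_def by (simp add: restr_tgr rule_enc_inj rule_tm_closed)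

lemma reach_tm_rule:
  "t \<in> subt L \<union> subt R \<Longrightarrow> reach (rg (tm_rule L R)) (rule_enc L R t) = rule_enc L R ` subt t"
  unfolding tm_rule_def by (simp add: reach_tgr rule_enc_inj rule_tm_closed)

lemma lhs_tm_rule: "lhs (tm_rule L R) = rule_enc L R L"
  and rhs_tm_rule: "rhs (tm_rule L R) = rule_enc L R R"
  by (simp_all add: tm_rule_def)

lemma lab_tm_rule:
  "t \<in> subt L \<union> subt R \<Longrightarrow> lab (rg (tm_rule L R)) (rule_enc L R t) = tlab t"
  unfolding tm_rule_def by (simp add: rule_enc_inj)

lemma att_tm_rule:
  "t \<in> subt L \<union> subt R \<Longrightarrow> att (rg (tm_rule L R)) (rule_enc L R t) = map (rule_enc L R) (targs t)"
  unfolding tm_rule_def by (simp add: rule_enc_inj)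

lemma lhsG_tm_rule: "lhsG (tm_rule L R) = tgt (rule_enc L R) L"
  and rhsG_tm_rule: "rhsG (tm_rule L R) = tgt (rule_enc L R) R"
  by (simp_all add: lhsG_def rhsG_def restr_tm_rule lhs_tm_rule rhs_tm_rule)

lemma rule_ok_tm_rule:
  assumes "wft S L" and "wft S R" and "L \<noteq> R"
    and vars: "\<And>x. Var x \<in> subt R \<Longrightarrow> Var x \<in> subt L"
  shows "rule_ok S (tm_rule L R)"
proof -
  have "lgraph_ok S (rg (tm_rule L R))"
    using assms(1,2) unfolding tm_rule_def
    by (auto intro!: lgraph_ok_tgr rule_enc_inj rule_tm_closed dest: wft_subt)
  moreover have "rule_enc L R L \<noteq> rule_enc L R R"
    using assms(3) rule_enc_inj[of L R] by (auto dest: inj_onD)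
  moreover have "rule_enc L R t \<in> rule_enc L R ` subt L"
    if "t \<in> subt R" "tlab t = None" for t
    using that vars by (cases t) auto
  ultimately show ?thesis
    by (auto simp: rule_ok_def lhs_tm_rule rhs_tm_rule reach_tm_rule lab_tm_rule)
      (auto simp: tm_rule_def)
qed

lemma over_C_tgt:
  assumes "inj_on e (subt t)" and "\<And>a ts. App a ts \<in> subt t \<Longrightarrow> a \<in> Con ` set (cons S)"
  shows "over_C S (tgt e t)"
proof -
  have "a \<in> Con ` set (cons S)" if "s \<in> subt t" "tlab s = Some a" for s a
    using that assms(2) by (cases s) auto
  then show ?thesis using assms(1) by (auto simp: over_C_def)
qed

lemma basic_tm_rule:
  assumes "f \<in> dfs S"
    and "\<And>t a ts. t \<in> set args \<Longrightarrow> App a ts \<in> subt t \<Longrightarrow> a \<in> Con ` set (cons S)"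
  shows "basic S (lhsG (tm_rule (App (Fn f) args) R))"
proof -
  let ?L = "App (Fn f) args" let ?e = "rule_enc ?L R"
  have inj: "inj_on ?e (subt ?L)" by (rule rule_enc_inj_lhs)
  have "over_C S (sub (tgt ?e ?L) (?e t))" if "t \<in> set args" for t
  proof -
    have "t \<in> subt ?L" using that by (rule arg_subt)
    then show ?thesis
      using assms(2) that inj inj_on_subset[OF inj subt_trans] by (simp add: sub_tgt over_C_tgt del: subt.simps)
  qed
  then show ?thesis
    using assms(1) inj by (auto simp: basic_def lhsG_tm_rule simp del: subt.simps)
qed

section \<open>Precedence termination on terms\<close>

text \<open>The structural part of \<open>pt\<close> on terms, with the label condition split off;
  \<open>args\<close> are the arguments of the left root and \<open>k\<close> is the number of
  normal ones. Clause (1) of \<open>pt\<close> becomes \<open>pt_arg\<close> and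
  \<open>pt_var\<close>: below an argument the comparison is with a constructor, which is minimal,
  so only an unlabeled node can be reached there.\<close>

inductive pt_tm :: "'c sig \<Rightarrow> nat \<Rightarrow> 'c sym tm list \<Rightarrow> 'c sym tm \<Rightarrow> bool" for S k args where
  pt_arg: "t \<in> set args \<Longrightarrow> pt_tm S k args t"
| pt_var: "t \<in> set args \<Longrightarrow> Var x \<in> subt t \<Longrightarrow> pt_tm S k args (Var x)"
| pt_app: "\<forall>t\<in>set (take (snn S a) ts). \<exists>s\<in>set (take k args). t \<in> subt s \<Longrightarrow>
    \<forall>t\<in>set (drop (snn S a) ts). pt_tm S k args t \<Longrightarrow> pt_tm S k args (App a ts)"

lemma pt_tgt_var:
  assumes "inj_on e (subt t)" and "Var x \<in> subt t" and "t \<noteq> Var x"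
  shows "pt S P (tgt e (Var x)) (tgt e t)"
  using assms
proof (induction t)
  case (App a ts)
  then obtain u where u: "u \<in> set ts" "Var x \<in> subt u" by auto
  have usub: "u \<in> subt (App a ts)" using u(1) by (rule arg_subt)
  then have inju: "inj_on e (subt u)" using App.prems(1) inj_on_subset subt_trans by blast
  show ?case
  proof (rule pt1[where u = "e u"])
    show "e u \<in> set (att (gr (tgt e (App a ts))) (root (tgt e (App a ts))))"
      using App.prems(1) u(1) by (simp del: subt.simps)
    show "tgt e (Var x) = sub (tgt e (App a ts)) (e u) \<or> pt S P (tgt e (Var x)) (sub (tgt e (App a ts)) (e u))"
      using App.IH[OF u(1) inju u(2)] App.prems(1) usub by (cases "u = Var x") (auto simp: sub_tgt simp del: subt.simps)
  qed (simp add: tgt_def tgr_def)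
qed simp

lemma nrm_tgt:
  "inj_on e (subt (App a ts)) \<Longrightarrow> nrm S (gr (tgt e (App a ts))) (e (App a ts)) = map e (take (snn S a) ts)"
  "inj_on e (subt (App a ts)) \<Longrightarrow> safe S (gr (tgt e (App a ts))) (e (App a ts)) = map e (drop (snn S a) ts)"
  by (simp_all add: nrm_def safe_def take_map drop_map del: subt.simps)

text \<open>Since every symbol of \<open>R\<close> is below \<open>f\<close>, the label condition of
  \<open>pt\<close> holds for all subterms of \<open>R\<close> at once, and the induction has to
  treat only the structural part.\<close>

lemma pt_tgt:
  assumes "pt_tm S (snn S f) args R"
    and "inj_on e (subt (App f args))"
    and "\<And>a ts. App a ts \<in> subt R \<Longrightarrow> (a, f) \<in> P"
    and "inj_on e (subt R)"
  shows "pt S P (tgt e R) (tgt e (App f args))"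
  using assms
proof (induction rule: pt_tm.induct)
  let ?L = "App f args"
  have labs: "\<forall>v\<in>nodes (gr (tgt e R)). \<forall>a. lab (gr (tgt e R)) v = Some a \<longrightarrow>
       (\<exists>b. lab (gr (tgt e ?L)) (root (tgt e ?L)) = Some b \<and> (a, b) \<in> P)"
    if "\<And>a ts. App a ts \<in> subt R \<Longrightarrow> (a, f) \<in> P" "inj_on e (subt R)" for R
  proof (intro ballI allI impI)
    fix v a assume "v \<in> nodes (gr (tgt e R))" and v: "lab (gr (tgt e R)) v = Some a"
    then obtain t where t: "t \<in> subt R" "v = e t" by auto
    with v that have "tlab t = Some a" by simp
    with t that have "(a, f) \<in> P" by (cases t) auto
    then show "\<exists>b. lab (gr (tgt e ?L)) (root (tgt e ?L)) = Some b \<and> (a, b) \<in> P"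
      using assms(2) by (simp del: subt.simps)
  qed
  {
    case (pt_arg t)
    show ?case
    proof (rule pt1[where u = "e t"])
      show "tgt e t = sub (tgt e ?L) (e t) \<or> pt S P (tgt e t) (sub (tgt e ?L) (e t))"
        using pt_arg assms(2) by (simp add: sub_tgt arg_subt del: subt.simps)
    qed (use pt_arg labs in \<open>blast, simp del: subt.simps\<close>)
  next
    case (pt_var t x)
    have "Var x \<in> subt ?L" using pt_var by auto
    then show ?case using assms(2) pt_tgt_var by blast
  next
    case (pt_app a ts)
    show ?case
    proof (rule pt2)
      show "lab (gr (tgt e (App a ts))) (root (tgt e (App a ts))) \<noteq> None"
        using pt_app.prems by (simp del: subt.simps)
      have sub: "sub (tgt e (App a ts)) (e t) = tgt e t" "inj_on e (subt t)" if "t \<in> set ts" for t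
        using sub_tgt[OF pt_app.prems(3) arg_subt[OF that]]
          inj_on_subset[OF pt_app.prems(3) subt_trans[OF arg_subt[OF that]]] by - assumption+
      show "\<forall>v\<in>set (safe S (gr (tgt e (App a ts))) (root (tgt e (App a ts)))).
         pt S P (sub (tgt e (App a ts)) v) (tgt e ?L)"
      proof
        fix v assume "v \<in> set (safe S (gr (tgt e (App a ts))) (root (tgt e (App a ts))))"
        then obtain t where t: "t \<in> set (drop (snn S a) ts)" "v = e t"
          using pt_app.prems(3) by (auto simp: nrm_tgt simp del: subt.simps)
        then have ts: "t \<in> set ts" by (auto dest: in_set_dropD)
        then have "pt S P (tgt e t) (tgt e ?L)"
          using pt_app.IH t(1) sub(2) pt_app.prems(2) subt_appI[OF ts] assms(2) by blast
        with ts show "pt S P (sub (tgt e (App a ts)) v) (tgt e ?L)"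
          using t sub by simp
      qed
      show "\<forall>v\<in>set (nrm S (gr (tgt e (App a ts))) (root (tgt e (App a ts)))).
         nrm_sub S (sub (tgt e (App a ts)) v) (tgt e ?L)"
      proof
        fix v assume "v \<in> set (nrm S (gr (tgt e (App a ts))) (root (tgt e (App a ts))))"
        then obtain t where t: "t \<in> set (take (snn S a) ts)" "v = e t"
          using pt_app.prems(3) by (auto simp: nrm_tgt simp del: subt.simps)
        then obtain s where s: "s \<in> set (take (snn S f) args)" "t \<in> subt s"
          using pt_app.hyps by blast
        have sL: "s \<in> subt ?L" using s(1) by (metis in_set_takeD arg_subt)
        then have injs: "inj_on e (subt s)" using assms(2) inj_on_subset subt_trans by blast
        have "t \<in> set ts" using t by (auto dest: in_set_takeD)
        then have "sub (tgt e (App a ts)) v = sub (sub (tgt e ?L) (e s)) (e t)"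
          using sub t s sL injs assms(2) by (simp add: sub_tgt del: subt.simps)
        moreover have "e t \<in> nodes (gr (sub (tgt e ?L) (e s)))"
          using sL s assms(2) by (simp add: sub_tgt del: subt.simps)
        moreover have "e s \<in> set (nrm S (gr (tgt e ?L)) (root (tgt e ?L)))"
          using s(1) assms(2) by (simp add: nrm_tgt del: subt.simps)
        ultimately show "nrm_sub S (sub (tgt e (App a ts)) v) (tgt e ?L)"
          unfolding nrm_sub_def by blast
      qed
    qed (use labs pt_app.prems in blast)
  }
qed

section \<open>Rewrite steps with term rules\<close>

definition tm_match :: "'f lgraph \<Rightarrow> ('f tm \<Rightarrow> nat) \<Rightarrow> 'f tm \<Rightarrow> bool" where
  "tm_match g \<mu> L \<longleftrightarrow> (\<forall>t\<in>subt L. \<mu> t \<in> nodes g \<and>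
     (\<forall>a ts. t = App a ts \<longrightarrow> lab g (\<mu> t) = Some a \<and> att g (\<mu> t) = map \<mu> ts))"

text \<open>The graph after build and redirection, before garbage collection. The map
  \<open>\<mu>\<close> plays two roles: on \<open>subt L\<close> it is the match, on
  \<open>subt R - subt L\<close> it names the fresh copies. The update of \<open>id\<close> is the
  redirection of the redex root.\<close>

definition step_graph :: "'f lgraph \<Rightarrow> ('f tm \<Rightarrow> nat) \<Rightarrow> 'f tm \<Rightarrow> 'f tm \<Rightarrow> 'f lgraph \<Rightarrow> bool" where
  "step_graph g \<mu> L R g' \<longleftrightarrow> nodes g' = nodes g \<union> \<mu> ` (subt R - subt L)
    \<and> (\<forall>v\<in>nodes g. lab g' v = lab g v \<and> att g' v = map (id(\<mu> L := \<mu> R)) (att g v))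
    \<and> (\<forall>t\<in>subt R - subt L. lab g' (\<mu> t) = tlab t \<and>
         att g' (\<mu> t) = map (id(\<mu> L := \<mu> R)) (map \<mu> (targs t)))"

lemma hom_tm_match:
  assumes "inj_on e (subt L)"
  shows "hom (tgt e L) g \<psi> \<longleftrightarrow> tm_match g (\<psi> \<circ> e) L"
proof -
  have "(tlab t \<noteq> None \<longrightarrow> lab g (\<psi> (e t)) = tlab t \<and> att g (\<psi> (e t)) = map \<psi> (map e (targs t)))
    \<longleftrightarrow> (\<forall>a ts. t = App a ts \<longrightarrow> lab g (\<psi> (e t)) = Some a \<and> att g (\<psi> (e t)) = map (\<psi> \<circ> e) ts)" for t
    by (cases t) auto
  then show ?thesis
    using assms by (auto simp: hom_def tm_match_def)
qed

lemma rstep_tm_rule_cases: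
  assumes "hom (lhsG (tm_rule L R)) (gr G) \<psi>"
    and "inj_on \<psi> (reach (rg (tm_rule L R)) (rhs (tm_rule L R)) - reach (rg (tm_rule L R)) (lhs (tm_rule L R)))"
    and "\<psi> ` (reach (rg (tm_rule L R)) (rhs (tm_rule L R)) - reach (rg (tm_rule L R)) (lhs (tm_rule L R)))
      \<inter> nodes (gr G) = {}"
  obtains \<mu> g' where "tm_match (gr G) \<mu> L" "inj_on \<mu> (subt R - subt L)"
    "\<mu> ` (subt R - subt L) \<inter> nodes (gr G) = {}" "step_graph (gr G) \<mu> L R g'"
    "step_result (tm_rule L R) G \<psi> = restr g' ((id(\<mu> L := \<mu> R)) (root G))"
proof -
  define e where "e = rule_enc L R"
  define \<mu> where "\<mu> = \<psi> \<circ> e"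
  define B where "B = subt R - subt L"
  define A where "A = reach (rg (tm_rule L R)) (rhs (tm_rule L R)) - reach (rg (tm_rule L R)) (lhs (tm_rule L R))"
  have inj: "inj_on e (subt L \<union> subt R)" unfolding e_def by (rule rule_enc_inj)
  \<comment> \<open>Joint injectivity of \<open>e\<close> on both sides makes the image of the
    difference equal to the difference of the images.\<close>
  have "e ` subt R - e ` subt L = e ` B"
    unfolding B_def using inj by (subst inj_on_image_set_diff[of e "subt L \<union> subt R"]) auto
  then have A: "A = e ` B"
    unfolding A_def e_def by (simp add: lhs_tm_rule rhs_tm_rule reach_tm_rule)
  have injB: "inj_on e B" using inj inj_on_subset unfolding B_def by blast
  have inj\<psi>: "inj_on \<psi> (e ` B)" using assms(2) A unfolding A_def by simp
  have dis: "\<psi> ` e ` B \<inter> nodes (gr G) = {}" using assms(3) A unfolding A_def by simp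
  let ?K = "rg (tm_rule L R)"
  define g' where "g' = \<lparr> nodes = nodes (gr G) \<union> \<psi> ` A,
      lab = (\<lambda>n. if n \<in> nodes (gr G) then lab (gr G) n
                  else if n \<in> \<psi> ` A then lab ?K (the_inv_into A \<psi> n) else None),
      att = (\<lambda>n. map (\<lambda>n. if n = \<psi> (e L) then \<psi> (e R) else n) (if n \<in> nodes (gr G) then att (gr G) n
                  else if n \<in> \<psi> ` A then map \<psi> (att ?K (the_inv_into A \<psi> n)) else [])) \<rparr>"
  have red: "(\<lambda>n. if n = \<psi> (e L) then \<psi> (e R) else n) = id(\<mu> L := \<mu> R)"
    by (auto simp: \<mu>_def)
  have "step_result (tm_rule L R) G \<psi> = restr g' ((\<lambda>n. if n = \<psi> (e L) then \<psi> (e R) else n) (root G))"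
    unfolding step_result_def g'_def A_def e_def Let_def lhs_tm_rule rhs_tm_rule by (rule refl)
  then have "step_result (tm_rule L R) G \<psi> = restr g' ((id(\<mu> L := \<mu> R)) (root G))"
    by (simp add: \<mu>_def)
  moreover have "step_graph (gr G) \<mu> L R g'"
  proof -
    have "lab g' (\<mu> t) = tlab t \<and> att g' (\<mu> t) = map (id(\<mu> L := \<mu> R)) (map \<mu> (targs t))" if t: "t \<in> B" for t
    proof -
      have n: "\<mu> t \<notin> nodes (gr G)" "\<mu> t \<in> \<psi> ` A" using t dis A by (auto simp: \<mu>_def)
      have "the_inv_into A \<psi> (\<mu> t) = e t"
        using t inj\<psi> unfolding A \<mu>_def by (simp add: the_inv_into_f_f)
      moreover have "lab ?K (e t) = tlab t" "att ?K (e t) = map e (targs t)"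
        using t unfolding B_def e_def by (auto intro: lab_tm_rule att_tm_rule)
      ultimately show ?thesis
        using n unfolding g'_def red by (simp add: \<mu>_def o_def)
    qed
    then show ?thesis
      unfolding step_graph_def B_def[symmetric]
      by (auto simp: g'_def red A \<mu>_def image_comp)
  qed
  moreover have "tm_match (gr G) \<mu> L"
    using assms(1) hom_tm_match[OF rule_enc_inj_lhs[of L R]] unfolding lhsG_tm_rule \<mu>_def e_def by blast
  moreover have "inj_on \<mu> B" unfolding \<mu>_def using injB inj\<psi> by (rule comp_inj_on)
  moreover have "\<mu> ` B \<inter> nodes (gr G) = {}" using dis by (simp add: \<mu>_def image_comp)
  ultimately show ?thesis using that unfolding B_def by blast
qed

text \<open>A match alone suffices for a step: fresh copies are always available, because the graph
  is finite.\<close>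

lemma rstep_tm_rule_exists:
  assumes "tm_rule L R \<in> Gs" and "tm_match (gr G) \<mu> L" and "finite (nodes (gr G))"
  shows "\<exists>H. rstep Gs G H"
proof -
  define e where "e = rule_enc L R"
  have inj: "inj_on e (subt L)" unfolding e_def by (rule rule_enc_inj_lhs)
  \<comment> \<open>Nodes outside the left-hand side are shifted past the largest node of
    \<open>G\<close>, which is injective and avoids \<open>G\<close>.\<close>
  define \<psi> where "\<psi> n = (if n \<in> e ` subt L then \<mu> (inv_into (subt L) e n) else n + Suc (Max (nodes (gr G))))" for n
  let ?A = "reach (rg (tm_rule L R)) (rhs (tm_rule L R)) - reach (rg (tm_rule L R)) (lhs (tm_rule L R))"
  have A: "?A \<inter> e ` subt L = {}"
    unfolding e_def by (auto simp: lhs_tm_rule reach_tm_rule)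
  have eq: "(\<psi> \<circ> e) t = \<mu> t" if "t \<in> subt L" for t
    using that inj by (simp add: \<psi>_def)
  have "tm_match (gr G) (\<psi> \<circ> e) L"
    unfolding tm_match_def
  proof (intro ballI conjI allI impI)
    fix t assume t: "t \<in> subt L"
    then show "(\<psi> \<circ> e) t \<in> nodes (gr G)"
      using eq[OF t] assms(2) by (simp add: tm_match_def)
    fix a ts assume ta: "t = App a ts"
    then have "map (\<psi> \<circ> e) ts = map \<mu> ts"
      using eq t arg_subt subt_trans by (metis (no_types, lifting) map_cong subset_iff)
    then show "lab (gr G) ((\<psi> \<circ> e) t) = Some a" "att (gr G) ((\<psi> \<circ> e) t) = map (\<psi> \<circ> e) ts"
      using t ta eq[OF t] assms(2) by (auto simp: tm_match_def simp del: subt.simps)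
  qed
  then have "hom (lhsG (tm_rule L R)) (gr G) \<psi>"
    using hom_tm_match[OF inj] by (simp add: lhsG_tm_rule e_def)
  moreover have "inj_on \<psi> ?A"
    using A by (auto simp: inj_on_def \<psi>_def)
  moreover have "\<psi> ` ?A \<inter> nodes (gr G) = {}"
  proof -
    have "n + Suc (Max (nodes (gr G))) \<notin> nodes (gr G)" for n
      using Max_ge[OF assms(3), of "n + Suc (Max (nodes (gr G)))"] by auto
    then show ?thesis using A by (auto simp: \<psi>_def)
  qed
  ultimately show ?thesis
    using assms(1) unfolding rstep_def by blast
qed

section \<open>Programs\<close>

text \<open>\<open>Expl\<close> is a single rule on variables (constants, constructors, projections,
  composition), \<open>Cases\<close> has one rule per constructor at the head of the first safe
  argument (predecessors, conditional), and \<open>Recur h\<close> has one rule per ground term,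
  where \<open>h c\<close> is the program index of the step function for \<open>c\<close>.\<close>

datatype 'c scheme = Expl "'c sym tm" | Cases "'c \<Rightarrow> 'c sym tm" | Recur "'c \<Rightarrow> nat"

datatype 'c entry = Entry (nn: nat) (ns: nat)
  (sem: "'c gterm list \<Rightarrow> 'c gterm list \<Rightarrow> 'c gterm") (scheme: "'c scheme")

fun ap :: "'c entry list \<Rightarrow> 'c sym \<Rightarrow> 'c gterm list \<Rightarrow> 'c gterm" where
  "ap P (Con c) us = T c us"
| "ap P (Fn i) us = sem (P ! i) (take (nn (P ! i)) us) (drop (nn (P ! i)) us)"

fun eval :: "'c entry list \<Rightarrow> (nat \<Rightarrow> 'c gterm) \<Rightarrow> 'c sym tm \<Rightarrow> 'c gterm" where
  "eval P \<sigma> (Var x) = \<sigma> x"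
| "eval P \<sigma> (App a ts) = ap P a (map (eval P \<sigma>) ts)"

fun fid :: "'c sym option \<Rightarrow> nat" where
  "fid (Some (Fn i)) = i"
| "fid _ = 0"

definition fnodes :: "('f \<Rightarrow> 'c sym option) \<Rightarrow> 'f set \<Rightarrow> 'f set" where
  "fnodes lb V = {v\<in>V. \<exists>i. lb v = Some (Fn i)}"

text \<open>The termination measure: the program indices of all nodes labeled by defined symbols,
  one entry per node.\<close>

definition fmset :: "('f \<Rightarrow> 'c sym option) \<Rightarrow> 'f set \<Rightarrow> nat multiset" where
  "fmset lb V = image_mset (\<lambda>v. fid (lb v)) (mset_set (fnodes lb V))"

locale constructors =
  fixes cs :: "'c list" and ar :: "'c \<Rightarrow> nat"
begin

definition sigof :: "'c entry list \<Rightarrow> 'c sig" where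
  "sigof P = \<lparr> cons = cs, car = ar, dfs = {..<length P},
     dar = (\<lambda>i. nn (P ! i) + ns (P ! i)), dnrm = (\<lambda>i. nn (P ! i)) \<rparr>"

lemma sigof_simps [simp]:
  "cons (sigof P) = cs" "car (sigof P) = ar" "dfs (sigof P) = {..<length P}"
  "dar (sigof P) i = nn (P ! i) + ns (P ! i)" "dnrm (sigof P) i = nn (P ! i)"
  by (simp_all add: sigof_def)

definition total :: "'c entry \<Rightarrow> bool" where
  "total E \<longleftrightarrow> (\<forall>xs ys. vargs cs ar (nn E) xs \<and> vargs cs ar (ns E) ys \<longrightarrow> gterm_ok cs ar (sem E xs ys))"

text \<open>The clauses gather what the separate goals need of a rule: basic left-hand sides and
  well-formedness for the constructor GRS, \<open>pt_tm\<close> for the structural part of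
  precedence termination, \<open>j < i\<close> for both the precedence and the multiset decrease,
  and the final equation for preservation of values.\<close>

definition trule_ok :: "'c entry list \<Rightarrow> nat \<Rightarrow> 'c sym tm list \<Rightarrow> 'c sym tm \<Rightarrow> bool" where
  "trule_ok P i args R \<longleftrightarrow> i < length P \<and> length args = nn (P ! i) + ns (P ! i)
    \<and> (\<forall>t\<in>set args. wft (sigof P) t \<and> (\<forall>a ts. App a ts \<in> subt t \<longrightarrow> a \<in> Con ` set cs))
    \<and> wft (sigof P) R
    \<and> (\<forall>x. Var x \<in> subt R \<longrightarrow> (\<exists>t\<in>set args. Var x \<in> subt t))
    \<and> pt_tm (sigof P) (nn (P ! i)) args R
    \<and> (\<forall>j ts. App (Fn j) ts \<in> subt R \<longrightarrow> j < i)
    \<and> (\<forall>\<sigma>. (\<forall>x. \<forall>t\<in>set args. Var x \<in> subt t \<longrightarrow> gterm_ok cs ar (\<sigma> x)) \<longrightarrow>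
         ap P (Fn i) (map (eval P \<sigma>) args) = eval P \<sigma> R)"

definition node_ok :: "'c entry list \<Rightarrow> nat set \<Rightarrow> nat set \<Rightarrow> (nat \<Rightarrow> 'c sym option) \<Rightarrow> (nat \<Rightarrow> nat list)
    \<Rightarrow> (nat \<Rightarrow> 'c gterm) \<Rightarrow> (nat \<Rightarrow> nat) \<Rightarrow> nat \<Rightarrow> bool" where
  "node_ok P N V lb at val rk v \<longleftrightarrow> set (at v) \<subseteq> V \<and> gterm_ok cs ar (val v) \<and> (\<forall>u\<in>set (at v). rk u < rk v)
     \<and> (\<exists>a. lb v = Some a \<and> a \<in> Fsyms (sigof P) \<and> length (at v) = sar (sigof P) a
          \<and> val v = ap P a (map val (at v)) \<and> set (take (snn (sigof P) a) (at v)) \<subseteq> N)"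

text \<open>Here \<open>val\<close> assigns to each node the value that it will eventually be rewritten to, \<open>rk\<close> witnesses
  acyclicity, and \<open>N\<close> consists of input nodes. It contains all normal arguments, so these stay maximally
  shared and the left-hand sides of recursion rules keep matching.\<close>

definition sound :: "'c entry list \<Rightarrow> nat set \<Rightarrow> nat set \<Rightarrow> (nat \<Rightarrow> 'c sym option) \<Rightarrow> (nat \<Rightarrow> nat list)
    \<Rightarrow> (nat \<Rightarrow> 'c gterm) \<Rightarrow> (nat \<Rightarrow> nat) \<Rightarrow> bool" where
  "sound P N V lb at val rk \<longleftrightarrow> finite V \<and> N \<subseteq> V \<and> inj_on val N
     \<and> (\<forall>v\<in>V. node_ok P N V lb at val rk v)
     \<and> (\<forall>v\<in>N. set (at v) \<subseteq> N \<and> (\<exists>c. lb v = Some (Con c)))"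

section \<open>Sound graphs: values, ranks and normal nodes under a match\<close>

lemma sound_nodeD:
  assumes "sound P N V lb at val rk" and "v \<in> V"
  shows "node_ok P N V lb at val rk v"
  using assms by (simp add: sound_def)

lemma sound_subset:
  assumes "sound P N V lb at val rk" and "U \<subseteq> V" and "\<And>v. v \<in> U \<Longrightarrow> set (at v) \<subseteq> U"
  shows "sound P (N \<inter> U) U lb at val rk"
proof -
  have "node_ok P (N \<inter> U) U lb at val rk v" if v: "v \<in> U" for v
  proof -
    have "node_ok P N V lb at val rk v" using assms(1,2) v by (auto simp: sound_def)
    then show ?thesis using assms(3)[OF v] by (fastforce simp: node_ok_def dest: in_set_takeD)
  qed
  moreover have "inj_on val (N \<inter> U)" using assms(1) by (auto simp: sound_def inj_on_def)
  moreover have "finite U" using assms(1,2) finite_subset by (auto simp: sound_def)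
  ultimately show ?thesis
    using assms by (auto simp: sound_def)
qed

lemma sound_cong:
  assumes "sound P N V lb at val rk" and "\<And>v. v \<in> V \<Longrightarrow> lb' v = lb v \<and> at' v = at v"
  shows "sound P N V lb' at' val rk"
  using assms by (auto simp: sound_def node_ok_def subset_iff)

lemma Fn_Fsyms [simp]: "Fn i \<in> Fsyms (sigof P) \<longleftrightarrow> i < length P"
  by (auto simp: Fsyms_def)

lemma Con_Fsyms [simp]: "Con c \<in> Fsyms (sigof P) \<longleftrightarrow> c \<in> set cs"
  by (auto simp: Fsyms_def)

lemma gterm_ok_ap:
  assumes "\<And>i. i < length P \<Longrightarrow> total (P ! i)" and "a \<in> Fsyms (sigof P)"
    and "length us = sar (sigof P) a" and "\<And>u. u \<in> set us \<Longrightarrow> gterm_ok cs ar u"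
  shows "gterm_ok cs ar (ap P a us)"
proof (cases a)
  case (Fn i)
  then have "total (P ! i)" using assms(1,2) by simp
  moreover have "vargs cs ar (nn (P ! i)) (take (nn (P ! i)) us)" "vargs cs ar (ns (P ! i)) (drop (nn (P ! i)) us)"
    using Fn assms(3,4) by (auto simp: vargs_def dest: in_set_takeD in_set_dropD)
  ultimately show ?thesis
    using Fn by (simp add: total_def)
qed (use assms in auto)

lemma gterm_ok_eval:
  assumes "\<And>i. i < length P \<Longrightarrow> total (P ! i)" and "wft (sigof P) t"
    and "\<And>x. Var x \<in> subt t \<Longrightarrow> gterm_ok cs ar (\<sigma> x)"
  shows "gterm_ok cs ar (eval P \<sigma> t)"
  using assms(2,3)
proof (induction t)
  case (App a ts)
  then have "gterm_ok cs ar (eval P \<sigma> t)" if "t \<in> set ts" for t using that by auto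
  then show ?case using App.prems assms(1) by (auto intro!: gterm_ok_ap)
qed simp

text \<open>A node built by a step is not a subterm of a left-hand argument, so the second
  alternative applies to it. This is why fresh nodes take their normal arguments from the input
  nodes.\<close>

lemma pt_tm_normal:
  assumes "pt_tm S k args R" and "App a ts \<in> subt R"
  shows "(\<exists>s\<in>set args. App a ts \<in> subt s) \<or> (\<forall>t\<in>set (take (snn S a) ts). \<exists>s\<in>set (take k args). t \<in> subt s)"
  using assms
proof (induction rule: pt_tm.induct)
  case (pt_app b us)
  show ?case
  proof (cases "App a ts = App b us")
    case True
    then show ?thesis using pt_app.hyps by simp
  next
    case False
    then obtain u where u: "u \<in> set us" "App a ts \<in> subt u" using pt_app.prems by auto
    then consider "u \<in> set (take (snn S b) us)" | "u \<in> set (drop (snn S b) us)"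
      by (metis UnE append_take_drop_id set_append)
    then show ?thesis
    proof cases
      case 1
      then obtain s where "s \<in> set (take k args)" "u \<in> subt s" using pt_app.hyps by blast
      then show ?thesis using u(2) subt_trans by (meson in_set_takeD subsetD)
    next
      case 2
      then show ?thesis using pt_app.IH u(2) by blast
    qed
  qed
qed auto

text \<open>In a sound graph the value of a node is determined by its label and the values of its
  successors, so a match acts as an evaluation whose assignment is read off at the
  variables.\<close>

lemma match_val:
  assumes "sound P N (nodes g) (lab g) (att g) val rk" and "tm_match g \<mu> L"
  shows "t \<in> subt L \<Longrightarrow> val (\<mu> t) = eval P (\<lambda>x. val (\<mu> (Var x))) t"
proof (induction t)
  case (App a ts)
  have n: "\<mu> (App a ts) \<in> nodes g" "lab g (\<mu> (App a ts)) = Some a" "att g (\<mu> (App a ts)) = map \<mu> ts"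
    using assms(2) App.prems by (auto simp: tm_match_def simp del: subt.simps)
  have "val (\<mu> t) = eval P (\<lambda>x. val (\<mu> (Var x))) t" if "t \<in> set ts" for t
    using App.IH[OF that] subt_trans[OF App.prems] arg_subt[OF that] by blast
  then have eq: "map (\<lambda>t. val (\<mu> t)) ts = map (eval P (\<lambda>x. val (\<mu> (Var x)))) ts" by simp
  have "val (\<mu> (App a ts)) = ap P a (map (\<lambda>t. val (\<mu> t)) ts)"
    using sound_nodeD[OF assms(1) n(1)] n by (simp add: node_ok_def comp_def)
  then show ?case unfolding eq by simp
qed simp

text \<open>Ranks decrease along edges, so although \<open>\<mu>\<close> may identify nodes, it
  never identifies a term with one of its proper subterms.\<close>

lemma match_rank:
  assumes "sound P N (nodes g) (lab g) (att g) val rk" and "tm_match g \<mu> L"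
  shows "t \<in> subt L \<Longrightarrow> s \<in> subt t \<Longrightarrow> s \<noteq> t \<Longrightarrow> rk (\<mu> s) < rk (\<mu> t)"
proof (induction t)
  case (App a ts)
  have n: "\<mu> (App a ts) \<in> nodes g" "att g (\<mu> (App a ts)) = map \<mu> ts"
    using assms(2) App.prems by (auto simp: tm_match_def simp del: subt.simps)
  obtain u where u: "u \<in> set ts" "s \<in> subt u" using App.prems by auto
  then have "rk (\<mu> u) < rk (\<mu> (App a ts))"
    using sound_nodeD[OF assms(1) n(1)] n by (auto simp: node_ok_def)
  moreover have "s = u \<or> rk (\<mu> s) < rk (\<mu> u)"
    using App.IH[OF u(1) _ u(2)] subt_trans[OF App.prems(1)] arg_subt[OF u(1)] by blast
  ultimately show ?case by auto
qed simp

lemma match_normal: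
  assumes "sound P N (nodes g) (lab g) (att g) val rk" and "tm_match g \<mu> L"
  shows "t \<in> subt L \<Longrightarrow> \<mu> t \<in> N \<Longrightarrow> s \<in> subt t \<Longrightarrow> \<mu> s \<in> N"
proof (induction t)
  case (App a ts)
  have n: "\<mu> (App a ts) \<in> nodes g" "att g (\<mu> (App a ts)) = map \<mu> ts"
    using assms(2) App.prems by (auto simp: tm_match_def simp del: subt.simps)
  show ?case
  proof (cases "s = App a ts")
    case False
    then obtain u where u: "u \<in> set ts" "s \<in> subt u" using App.prems by auto
    moreover have "set (map \<mu> ts) \<subseteq> N"
      using assms(1) App.prems(2) n(2) unfolding sound_def by metis
    ultimately show ?thesis
      using App.IH[OF u(1) subsetD[OF subt_trans[OF App.prems(1)] arg_subt[OF u(1)]] _ u(2)] by auto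
  qed (use App.prems in simp)
qed simp

text \<open>Here \<open>w\<close> is the redex root, \<open>B\<close> the fresh nodes and
  \<open>U\<close> the nodes that survive garbage collection. The old part \<open>X\<close>
  contributes equally on both sides; the removed part \<open>Z\<close> contains \<open>w\<close>,
  whose index \<open>i\<close> exceeds every index contributed by the new part \<open>Y\<close>.
  Further nodes lost to garbage collection only enlarge \<open>Z\<close>.\<close>

lemma fmset_decrease:
  assumes "finite V" and "U \<subseteq> (V - {w}) \<union> B" and "B \<inter> V = {}" and "finite B"
    and "w \<in> V" and "lb w = Some (Fn i)" and "\<And>v. v \<in> V \<Longrightarrow> lb' v = lb v"
    and "\<And>v j. v \<in> B \<Longrightarrow> lb' v = Some (Fn j) \<Longrightarrow> j < i"
  shows "(fmset lb' U, fmset lb V) \<in> mult less_than"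
proof -
  define X where "X = fnodes lb' U \<inter> V"
  define Y where "Y = fnodes lb' U - V"
  define Z where "Z = fnodes lb V - X"
  have fin: "finite X" "finite Y" "finite Z"
    using assms(1,2,4) finite_subset[of U "(V - {w}) \<union> B"] by (auto simp: X_def Y_def Z_def fnodes_def)
  have XV: "X \<subseteq> fnodes lb V" "w \<in> Z" "Y \<subseteq> B" "X \<inter> Y = {}" "fnodes lb' U = X \<union> Y"
    using assms(2,3,5,6,7) by (auto simp: X_def Y_def Z_def fnodes_def)
  have "fnodes lb V = X \<union> Z" "X \<inter> Z = {}" using XV(1) by (auto simp: Z_def)
  then have 1: "fmset lb V = image_mset (\<lambda>v. fid (lb v)) (mset_set X) + image_mset (\<lambda>v. fid (lb v)) (mset_set Z)"
    using fin by (simp add: fmset_def mset_set_Union)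
  have "image_mset (\<lambda>v. fid (lb' v)) (mset_set X) = image_mset (\<lambda>v. fid (lb v)) (mset_set X)"
    using fin(1) assms(7) by (intro image_mset_cong) (auto simp: X_def)
  then have 2: "fmset lb' U = image_mset (\<lambda>v. fid (lb v)) (mset_set X) + image_mset (\<lambda>v. fid (lb' v)) (mset_set Y)"
    using fin XV(4,5) by (simp add: fmset_def mset_set_Union)
  have "\<exists>j\<in>#image_mset (\<lambda>v. fid (lb v)) (mset_set Z). (k, j) \<in> less_than"
    if k: "k \<in># image_mset (\<lambda>v. fid (lb' v)) (mset_set Y)" for k
  proof -
    obtain v where v: "v \<in> Y" "k = fid (lb' v)" using k fin(2) by auto
    then obtain j where "lb' v = Some (Fn j)" by (auto simp: Y_def fnodes_def)
    then have "k < i" using v assms(8) XV(3) by auto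
    then show ?thesis using XV(2) fin(3) assms(6) by (auto intro!: bexI[of _ w])
  qed
  moreover have "image_mset (\<lambda>v. fid (lb v)) (mset_set Z) \<noteq> {#}"
    using XV(2) fin(3) by (metis elem_mset_set empty_iff image_mset_is_empty_iff set_mset_empty)
  ultimately show ?thesis unfolding 1 2 by (intro one_step_implies_mult) auto
qed

text \<open>The witnesses \<open>N\<close>, \<open>val\<close> and \<open>rk\<close> are quantified
  per graph, so a step may choose new ones; only the value \<open>x\<close> of the root is fixed
  along a rewrite sequence.\<close>

definition invar :: "'c entry list \<Rightarrow> 'c gterm \<Rightarrow> 'c sym tgraph \<Rightarrow> bool" where
  "invar P x G \<longleftrightarrow> root G \<in> nodes (gr G) \<and>
     (\<exists>N val rk. sound P N (nodes (gr G)) (lab (gr G)) (att (gr G)) val rk \<and> val (root G) = x)"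

lemma invar_restr:
  assumes "sound P N V (lab g) (att g) val rk" and "V \<subseteq> nodes g" and "v \<in> V" and "val v = x"
  shows "invar P x (restr g v)" and "reach g v \<subseteq> V"
proof -
  show sub: "reach g v \<subseteq> V"
    using assms by (intro reach_closed) (auto simp: sound_def node_ok_def)
  have vr: "v \<in> reach g v" by (simp add: reach_def)
  have "set (att g u) \<subseteq> reach g v" if "u \<in> reach g v" for u
  proof
    fix w assume "w \<in> set (att g u)"
    then have "(u, w) \<in> edges g" using that sub assms(2) by (auto simp: edges_def)
    then show "w \<in> reach g v" using that by (simp add: reach_def)
  qed
  then have "sound P (N \<inter> reach g v) (reach g v) (lab g) (att g) val rk"
    using sound_subset[OF assms(1) sub] by blast
  then have "sound P (N \<inter> reach g v) (reach g v) (lab (gr (restr g v))) (att (gr (restr g v))) val rk"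
    by (rule sound_cong) (simp add: restr_def)
  then show "invar P x (restr g v)"
    using vr assms(4) by (auto simp: invar_def restr_def)
qed

text \<open>Fresh nodes receive the value of the subterm of \<open>R\<close> that they instantiate.
  Redirection from \<open>\<mu> L\<close> to \<open>\<mu> R\<close> is harmless for values because
  the rule is semantically sound, so both nodes have the same value. The ranks have to be rebuilt to
  make room for the fresh nodes.\<close>

lemma step_preserves:
  assumes inv: "invar P x G" and rule: "trule_ok P i args R"
    and tot: "\<And>j. j < length P \<Longrightarrow> total (P ! j)"
    and L: "L = App (Fn i) args"
    and m: "tm_match (gr G) \<mu> L" and injB: "inj_on \<mu> (subt R - subt L)"
    and fresh: "\<mu> ` (subt R - subt L) \<inter> nodes (gr G) = {}"
    and sg: "step_graph (gr G) \<mu> L R g'"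
    and H: "H = restr g' ((id(\<mu> L := \<mu> R)) (root G))"
  shows "invar P x H \<and> (fmset (lab (gr H)) (nodes (gr H)), fmset (lab (gr G)) (nodes (gr G))) \<in> mult less_than"
proof -
  define g where "g = gr G"
  define B where "B = subt R - subt L"
  define red where "red = id(\<mu> L := \<mu> R)"
  obtain N val rk where s: "sound P N (nodes g) (lab g) (att g) val rk" and rx: "val (root G) = x"
    and rG: "root G \<in> nodes g"
    using inv by (auto simp: invar_def g_def)
  note m = m[folded g_def] and fresh = fresh[folded g_def B_def] and injB = injB[folded B_def]
  note sg = sg[folded g_def]
  define \<sigma> where "\<sigma> x = val (\<mu> (Var x))" for x
  \<comment> \<open>Redirection leaves no edge from a node of \<open>V\<close> to the redex root, so
    \<open>V\<close> contains everything reachable; it may still contain other garbage.\<close>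
  define V where "V = nodes g - {\<mu> L} \<union> \<mu> ` B"
  define val' where "val' v = (if v \<in> nodes g then val v else eval P \<sigma> (inv_into B \<mu> v))" for v
  \<comment> \<open>Old ranks are stretched by \<open>M\<close>, which exceeds the size of every
    subterm of \<open>R\<close>. Fresh nodes, ordered by term size, then fit above all proper
    subterms of \<open>L\<close> (old rank at most \<open>rk (\<mu> L) - 1\<close>) and below every
    parent of the redex root. Truncated subtraction is safe at rank 0, where \<open>L\<close> has no
    proper subterms.\<close>
  define M where "M = Suc (size R)"
  define rk' where "rk' v = (if v \<in> nodes g then M * rk v else M * (rk (\<mu> L) - 1) + size (inv_into B \<mu> v))" for v

  have Lin: "\<mu> t \<in> nodes g" if "t \<in> subt L" for t using m that by (simp add: tm_match_def)
  have LL: "\<mu> L \<in> nodes g" "lab g (\<mu> L) = Some (Fn i)" "att g (\<mu> L) = map \<mu> args"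
    using m L by (auto simp: tm_match_def)
  \<comment> \<open>All defined symbols of \<open>R\<close> have an index below \<open>i\<close>, so
    the root symbol of \<open>L\<close> cannot occur in \<open>R\<close>.\<close>
  have RL: "L \<notin> subt R"
    using rule by (auto simp: trule_ok_def L)
  have labR: "j < i" if "App (Fn j) ts \<in> subt R" for j ts
    using rule that by (auto simp: trule_ok_def)
  \<comment> \<open>Variables of \<open>R\<close> already occur in \<open>L\<close>, so all fresh
    nodes are labeled and the graph stays closed.\<close>
  have BApp: "\<exists>a ts. t = App a ts" if "t \<in> B" for t
    using that rule by (cases t) (auto simp: B_def L trule_ok_def)
  have sub: "subt t \<subseteq> subt L \<union> B" if "t \<in> B" for t
    using that subt_trans by (fastforce simp: B_def)
  have \<sigma>: "\<sigma> = (\<lambda>x. val (\<mu> (Var x)))" by (simp add: \<sigma>_def fun_eq_iff)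
  have val'L: "val' (\<mu> t) = eval P \<sigma> t" if "t \<in> subt L" for t
    using match_val[OF s m that] Lin[OF that] by (simp add: val'_def \<sigma>)
  have val'B: "val' (\<mu> t) = eval P \<sigma> t" if "t \<in> B" for t
    using that fresh injB by (auto simp: val'_def)
  have val': "val' (\<mu> t) = eval P \<sigma> t" if "t \<in> subt L \<union> B" for t
    using that val'L val'B by auto
  have \<sigma>ok: "gterm_ok cs ar (\<sigma> x)" if "Var x \<in> subt L" for x
    using sound_nodeD[OF s Lin[OF that]] by (simp add: node_ok_def \<sigma>_def)
  have "ap P (Fn i) (map (eval P \<sigma>) args) = eval P \<sigma> R"
    using rule \<sigma>ok unfolding trule_ok_def L by (metis subt_appI)
  then have LR: "eval P \<sigma> L = eval P \<sigma> R" by (simp add: L)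
  have Rin: "R \<in> subt L \<union> B" by (simp add: B_def)
  have red_val: "val' (red v) = val' v" for v
    using val'[OF Rin] val'L[of L] LR by (simp add: red_def)
  \<comment> \<open>Redirection must not lead back to the redex root. The delicate case is a
    collapsing rule, where \<open>R\<close> is a proper subterm of \<open>L\<close> and only the
    ranks separate the two images.\<close>
  have RneL: "\<mu> R \<noteq> \<mu> L"
  proof (cases "R \<in> B")
    case True
    then show ?thesis using fresh LL(1) by auto
  next
    case False
    then have "R \<in> subt L" using Rin by auto
    then have "rk (\<mu> R) < rk (\<mu> L)" using match_rank[OF s m, of L R] RL by fastforce
    then show ?thesis by auto
  qed
  have RV: "\<mu> R \<in> V"
    using Rin Lin RneL by (auto simp: V_def)
  have redV: "red v \<in> V" if "v \<in> nodes g" for v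
    using that RV by (auto simp: red_def V_def)
  have neL: "\<mu> t \<noteq> \<mu> L \<and> (t \<in> subt L \<longrightarrow> rk (\<mu> t) < rk (\<mu> L))" if "t \<in> subt L \<union> B" "t \<noteq> L" for t
    using that match_rank[OF s m, of L t] fresh LL(1) by fastforce
  \<comment> \<open>Input nodes carry constructors, so the redex root is not among them and
    redirection fixes \<open>N\<close> pointwise.\<close>
  have Nfn: "\<mu> L \<notin> N" using s LL(2) by (auto simp: sound_def)
  have redN: "red v = v" if "v \<in> N" for v
    using that Nfn by (auto simp: red_def)

  have old: "lab g' v = lab g v" "att g' v = map red (att g v)" if "v \<in> nodes g" for v
    using sg that by (auto simp: step_graph_def red_def)
  have new: "lab g' (\<mu> t) = tlab t" "att g' (\<mu> t) = map red (map \<mu> (targs t))" if "t \<in> B" for t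
    using sg that by (auto simp: step_graph_def red_def B_def)
  have rkold: "rk' (red u) < rk' v" if "v \<in> nodes g" "u \<in> nodes g" "rk u < rk v" for u v
  proof (cases "u = \<mu> L")
    case False
    then show ?thesis using that by (simp add: red_def rk'_def M_def del: mult_Suc)
  next
    case True
    show ?thesis
    proof (cases "R \<in> B")
      case False
      then have "R \<in> subt L" "R \<noteq> L" using Rin RL by auto
      then have "rk (\<mu> R) < rk v" "\<mu> R \<in> nodes g" using neL True that Lin by fastforce+
      then show ?thesis using that True by (simp add: red_def rk'_def M_def del: mult_Suc)
    next
      case RB: True
      then have "\<mu> R \<notin> nodes g" "inv_into B \<mu> (\<mu> R) = R" using fresh injB by auto
      then have "rk' (red u) = M * (rk u - 1) + size R" using True by (simp add: red_def rk'_def)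
      also have "\<dots> < M * (rk u - 1) + M * 1" by (simp add: M_def)
      also have "\<dots> \<le> M * rk v" unfolding add_mult_distrib2[symmetric] using that(3) by (intro mult_le_mono) auto
      finally show ?thesis using that by (simp add: rk'_def)
    qed
  qed
  have rknew: "rk' (\<mu> u) < rk' (\<mu> t)" if t: "t \<in> B" "u \<in> set (targs t)" "u \<noteq> L" for u t
  proof -
    have uin: "u \<in> subt L \<union> B" using sub[OF t(1)] targs_subt[OF t(2)] by blast
    have rt: "rk' (\<mu> t) = M * (rk (\<mu> L) - 1) + size t" using t(1) fresh injB by (auto simp: rk'_def)
    have st: "size u < size t" using t(2) by (rule targs_size)
    show ?thesis
    proof (cases "u \<in> B")
      case True
      then have "rk' (\<mu> u) = M * (rk (\<mu> L) - 1) + size u" using fresh injB by (auto simp: rk'_def)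
      then show ?thesis using rt st by simp
    next
      case False
      then have uL: "u \<in> subt L" using uin by auto
      then have "rk (\<mu> u) \<le> rk (\<mu> L) - 1" using neL[OF uin t(3)] by linarith
      then have "rk' (\<mu> u) \<le> M * (rk (\<mu> L) - 1)" using Lin[OF uL] by (simp add: rk'_def)
      then show ?thesis using rt st by simp
    qed
  qed

  have "node_ok P N V (lab g') (att g') val' rk' v" if v: "v \<in> V" for v
  proof (cases "v \<in> nodes g")
    case True
    note n = sound_nodeD[OF s True, unfolded node_ok_def]
    then obtain a where a: "lab g v = Some a" "a \<in> Fsyms (sigof P)" "length (att g v) = sar (sigof P) a"
          "val v = ap P a (map val (att g v))" "set (take (snn (sigof P) a) (att g v)) \<subseteq> N" by blast
    have mv: "map val' (att g' v) = map val (att g v)"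
    proof -
      have "val' u = val u" if "u \<in> set (att g v)" for u
        using n that by (auto simp: val'_def)
      then show ?thesis using True by (simp add: old red_val)
    qed
    have "val' v = ap P a (map val' (att g' v))" "gterm_ok cs ar (val' v)" "lab g' v = Some a"
        "length (att g' v) = sar (sigof P) a"
      unfolding mv using a n True by (auto simp: val'_def old)
    moreover have "set (take (snn (sigof P) a) (att g' v)) \<subseteq> N"
      using a(5) redN True by (auto simp: old take_map subset_iff)
    moreover have "set (att g' v) \<subseteq> V" using n redV True by (auto simp: old)
    moreover have "\<forall>u\<in>set (att g' v). rk' u < rk' v"
      using n rkold[OF True] True by (auto simp: old)
    ultimately show ?thesis
      unfolding node_ok_def using a(2) by blast
  next
    case False
    then obtain t where t: "t \<in> B" "v = \<mu> t" using v by (auto simp: V_def)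
    then obtain a ts where ta: "t = App a ts" using BApp by blast
    have tR: "App a ts \<in> subt R" using t ta by (simp add: B_def)
    then have wf: "wft (sigof P) (App a ts)"
      using rule wft_subt by (auto simp: trule_ok_def simp del: wft.simps)
    have tsin: "u \<in> subt L \<union> B" "u \<noteq> L" if "u \<in> set ts" for u
    proof -
      show "u \<in> subt L \<union> B" using sub[OF t(1)] arg_subt[OF that] ta by blast
      show "u \<noteq> L" using RL subt_trans[OF tR] arg_subt[OF that] by blast
    qed
    have redts: "red (\<mu> u) = \<mu> u" if "u \<in> set ts" for u
      using neL[OF tsin[OF that]] by (simp add: red_def)
    have at: "att g' v = map \<mu> ts" using new(2)[OF t(1)] t ta redts by simp
    have lb: "lab g' v = Some a" using new(1)[OF t(1)] t ta by simp
    have vv: "val' v = eval P \<sigma> (App a ts)" using val'B[OF t(1)] t ta by simp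
    have "map val' (att g' v) = map (eval P \<sigma>) ts"
      using at tsin val' by simp
    then have 1: "val' v = ap P a (map val' (att g' v))" using vv by simp
    have "gterm_ok cs ar (eval P \<sigma> (App a ts))"
    proof (rule gterm_ok_eval[OF tot wf])
      fix x assume "Var x \<in> subt (App a ts)"
      then have "Var x \<in> subt L \<union> B" using sub[OF t(1)] ta by blast
      then show "gterm_ok cs ar (\<sigma> x)" using \<sigma>ok BApp by blast
    qed
    then have 2: "gterm_ok cs ar (val' v)" using vv by simp
    have "\<not> (\<exists>s\<in>set args. App a ts \<in> subt s)"
      using t ta by (auto simp: B_def L)
    then have nr: "\<forall>u\<in>set (take (snn (sigof P) a) ts). \<exists>s\<in>set (take (nn (P ! i)) args). u \<in> subt s"
      using pt_tm_normal[OF _ tR] rule unfolding trule_ok_def by blast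
    have "\<mu> u \<in> N" if u: "u \<in> set (take (snn (sigof P) a) ts)" for u
    proof -
      obtain s where s': "s \<in> set (take (nn (P ! i)) args)" "u \<in> subt s" using nr u by blast
      have "set (take (nn (P ! i)) (map \<mu> args)) \<subseteq> N"
        using sound_nodeD[OF s LL(1)] LL by (auto simp: node_ok_def)
      then have "\<mu> s \<in> N" using s'(1) by (auto simp: take_map)
      moreover have "s \<in> subt L" using s'(1) L arg_subt by (metis in_set_takeD)
      ultimately show ?thesis using match_normal[OF s m] s'(2) by blast
    qed
    then have 3: "set (take (snn (sigof P) a) (att g' v)) \<subseteq> N" using at by (auto simp: take_map)
    have 4: "set (att g' v) \<subseteq> V"
      using at tsin neL Lin by (fastforce simp: V_def)
    have 5: "\<forall>u\<in>set (att g' v). rk' u < rk' v"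
      using rknew[OF t(1)] tsin at t ta by auto
    show ?thesis
      unfolding node_ok_def using 1 2 3 4 5 lb wf at by auto
  qed
  moreover have NV: "N \<subseteq> nodes g" "inj_on val N"
    and Ncl: "\<And>v. v \<in> N \<Longrightarrow> set (att g v) \<subseteq> N \<and> (\<exists>c. lab g v = Some (Con c))"
    using s by (auto simp: sound_def)
  moreover have "inj_on val' N"
    using NV by (auto simp: inj_on_def val'_def subset_iff)
  moreover have "set (att g' v) \<subseteq> N \<and> (\<exists>c. lab g' v = Some (Con c))" if "v \<in> N" for v
    using Ncl[OF that] NV(1) that redN by (auto simp: old subset_iff)
  moreover have finB: "finite (\<mu> ` B)" by (simp add: B_def)
  moreover have fing: "finite (nodes g)" using s by (simp add: sound_def)
  ultimately have s': "sound P N V (lab g') (att g') val' rk'"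
    using Nfn by (auto simp: sound_def V_def)
  have V: "V \<subseteq> nodes g'" using sg by (auto simp: step_graph_def V_def B_def)
  have rV: "red (root G) \<in> V" using redV rG by simp
  have "val' (red (root G)) = x" using red_val rG rx by (simp add: val'_def)
  note res = invar_restr[OF s' V rV this]
  have HG: "H = restr g' (red (root G))" using H by (simp add: red_def)
  have "(fmset (lab g') (reach g' (red (root G))), fmset (lab g) (nodes g)) \<in> mult less_than"
  proof (rule fmset_decrease[where lb = "lab g" and w = "\<mu> L", OF fing _ fresh finB LL(1,2)])
    show "reach g' (red (root G)) \<subseteq> nodes g - {\<mu> L} \<union> \<mu> ` B" using res(2) by (simp add: V_def)
    show "\<And>v. v \<in> nodes g \<Longrightarrow> lab g' v = lab g v" by (rule old)
    fix v j assume v: "v \<in> \<mu> ` B" and l: "lab g' v = Some (Fn j)"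
    obtain t where t: "t \<in> B" "v = \<mu> t" using v by blast
    then obtain a ts where ta: "t = App a ts" using BApp by blast
    then have "App (Fn j) ts \<in> subt R" using t new(1)[OF t(1)] l by (simp add: B_def)
    then show "j < i" by (rule labR)
  qed
  moreover have "fmset (lab (gr H)) (nodes (gr H)) = fmset (lab g') (reach g' (red (root G)))"
  proof -
    have *: "fnodes (lab (gr H)) (nodes (gr H)) = fnodes (lab g') (reach g' (red (root G)))"
      by (auto simp: HG restr_def fnodes_def)
    have "finite (reach g' (red (root G)))" using res(2) s' finite_subset by (auto simp: sound_def)
    then show ?thesis
      unfolding fmset_def * by (intro image_mset_cong) (auto simp: HG restr_def fnodes_def)
  qed
  ultimately show ?thesis
    using res(1) HG by (simp add: g_def)
qed

end

section \<open>The graph rewrite system of a program\<close>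

text \<open>The block \<open>map Var [0..<m]\<close> holds the remaining normal and the safe
  parameters of the recursion together. The normal/safe border of \<open>h c\<close> runs through
  this block: constructor arguments and normal parameters precede it, safe parameters and recursive
  results follow.\<close>

fun unfolding_tm :: "('c \<Rightarrow> nat) \<Rightarrow> nat \<Rightarrow> 'c gterm \<Rightarrow> 'c sym tm" where
  "unfolding_tm h m (T c ts) = App (Fn (h c)) (map emb ts @ map Var [0..<m] @ map (unfolding_tm h m) ts)"

lemma emb_inj: "emb s = emb t \<Longrightarrow> s = t"
proof (induction s arbitrary: t)
  case (T c ss)
  then obtain ts where t: "t = T c ts" and eq: "map emb ss = map emb ts" by (cases t) auto
  then have len: "length ss = length ts" using map_eq_imp_length_eq by blast
  have "emb (ss ! i) = emb (ts ! i)" if "i < length ss" for i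
    using eq that len by (metis nth_map)
  then have "ss = ts" using T.IH len by (intro nth_equalityI) auto
  then show ?case using t by simp
qed

lemma inv_emb [simp]: "inv emb (emb t) = t"
  by (simp add: inv_f_f inj_def emb_inj)

lemma subt_emb_Con: "s \<in> subt (emb t) \<Longrightarrow> \<exists>u. s = emb u"
  by (induction t) (auto intro: exI[of _ "T _ _"])

context constructors
begin

text \<open>Variables are numbered in left-to-right order. In \<open>Cases\<close> the numbers below
  \<open>ar c\<close> are the arguments of the pattern and the other safe arguments follow; in
  \<open>Recur\<close> the recursion argument is ground, so numbering starts at the argument after
  it and one variable fewer than the arity is needed.\<close>

definition erules :: "'c entry \<Rightarrow> ('c sym tm list \<times> 'c sym tm) set" where
  "erules E = (case scheme E of
      Expl R \<Rightarrow> {(map Var [0..<nn E + ns E], R)}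
    | Cases B \<Rightarrow> (\<lambda>c. (App (Con c) (map Var [0..<ar c]) # map Var [ar c..<ar c + (ns E - 1)], B c)) ` set cs
    | Recur h \<Rightarrow> (\<lambda>t. (emb t # map Var [0..<nn E + ns E - 1], unfolding_tm h (nn E + ns E - 1) t)) `
        {t. gterm_ok cs ar t})"

definition shape_ok :: "'c entry list \<Rightarrow> 'c entry \<Rightarrow> bool" where
  "shape_ok P E \<longleftrightarrow> (case scheme E of
      Expl R \<Rightarrow> True
    | Cases B \<Rightarrow> nn E = 0 \<and> 0 < ns E
    | Recur h \<Rightarrow> 0 < nn E \<and> (\<forall>c\<in>set cs. h c < length P \<and> nn (P ! h c) = ar c + (nn E - 1)))"

definition good :: "'c entry list \<Rightarrow> bool" where
  "good P \<longleftrightarrow> (\<forall>i<length P. shape_ok P (P ! i) \<and> total (P ! i)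
     \<and> (\<forall>(args, R)\<in>erules (P ! i). trule_ok P i args R))"

definition grs :: "'c entry list \<Rightarrow> 'c sym rule set" where
  "grs P = {tm_rule (App (Fn i) args) R | i args R. i < length P \<and> (args, R) \<in> erules (P ! i)}"

lemma good_rule: "good P \<Longrightarrow> i < length P \<Longrightarrow> (args, R) \<in> erules (P ! i) \<Longrightarrow> trule_ok P i args R"
  by (auto simp: good_def)

lemma good_total: "good P \<Longrightarrow> i < length P \<Longrightarrow> total (P ! i)"
  by (auto simp: good_def)

lemma good_shape: "good P \<Longrightarrow> i < length P \<Longrightarrow> shape_ok P (P ! i)"
  by (auto simp: good_def)

lemma rstep_preserves:
  assumes "good P" and "invar P x G" and "rstep (grs P) G H"
  shows "invar P x H" and "(fmset (lab (gr H)) (nodes (gr H)), fmset (lab (gr G)) (nodes (gr G))) \<in> mult less_than"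
proof -
  obtain i args R \<psi> where i: "i < length P" "(args, R) \<in> erules (P ! i)"
    and \<psi>: "hom (lhsG (tm_rule (App (Fn i) args) R)) (gr G) \<psi>"
      "inj_on \<psi> (reach (rg (tm_rule (App (Fn i) args) R)) (rhs (tm_rule (App (Fn i) args) R))
         - reach (rg (tm_rule (App (Fn i) args) R)) (lhs (tm_rule (App (Fn i) args) R)))"
      "\<psi> ` (reach (rg (tm_rule (App (Fn i) args) R)) (rhs (tm_rule (App (Fn i) args) R))
         - reach (rg (tm_rule (App (Fn i) args) R)) (lhs (tm_rule (App (Fn i) args) R))) \<inter> nodes (gr G) = {}"
    and H: "H = step_result (tm_rule (App (Fn i) args) R) G \<psi>"
    using assms(3) unfolding rstep_def grs_def by blast
  obtain \<mu> g' where "tm_match (gr G) \<mu> (App (Fn i) args)" "inj_on \<mu> (subt R - subt (App (Fn i) args))"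
    "\<mu> ` (subt R - subt (App (Fn i) args)) \<inter> nodes (gr G) = {}" "step_graph (gr G) \<mu> (App (Fn i) args) R g'"
    "H = restr g' ((id(\<mu> (App (Fn i) args) := \<mu> R)) (root G))"
    unfolding H by (rule rstep_tm_rule_cases[OF \<psi>])
  then have "invar P x H \<and> (fmset (lab (gr H)) (nodes (gr H)), fmset (lab (gr G)) (nodes (gr G))) \<in> mult less_than"
    using assms(1,2) i by (intro step_preserves[OF _ good_rule]) (auto simp: good_total simp del: subt.simps)
  then show "invar P x H" and "(fmset (lab (gr H)) (nodes (gr H)), fmset (lab (gr G)) (nodes (gr G))) \<in> mult less_than"
    by blast+
qed

text \<open>Together with injectivity of \<open>val\<close> on \<open>N\<close>, this makes the
  inverse of \<open>val\<close> a total and unambiguous match for a ground pattern sitting at a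
  normal position.\<close>

lemma normal_nodes_emb:
  assumes "sound P N V lb at val rk"
  shows "w \<in> N \<Longrightarrow> t \<in> subt (emb (val w)) \<Longrightarrow> \<exists>u\<in>N. t = emb (val u)"
proof (induction "val w" arbitrary: w)
  case (T c ts)
  then have wV: "w \<in> V" using assms by (auto simp: sound_def)
  obtain b where b: "lb w = Some (Con b)" and sub: "set (at w) \<subseteq> N"
    using assms T.prems(1) by (auto simp: sound_def)
  then have "val w = T b (map val (at w))"
    using sound_nodeD[OF assms wV] by (auto simp: node_ok_def)
  then have ts: "ts = map val (at w)" using T.hyps(2) by simp
  show ?case
  proof (cases "t = emb (val w)")
    case False
    then obtain s where s: "s \<in> set ts" "t \<in> subt (emb s)"
      using T.prems(2) T.hyps(2)[symmetric] by auto
    then obtain u where u: "u \<in> set (at w)" "s = val u" using ts by auto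
    then have uN: "u \<in> N" using sub by auto
    have "t \<in> subt (emb (val u))" using s(2) u(2) by simp
    with T.hyps(1)[OF s(1)[unfolded u(2)] uN] show ?thesis by blast
  qed (use T.prems in auto)
qed

text \<open>At a defined node of least rank all successors carry constructors. A rule with variables
  only, or with one constructor pattern, then matches by reading off successors. For recursion the
  rule of the ground term \<open>val w\<close> is chosen, \<open>w\<close> being the first
  argument.\<close>

lemma progress:
  assumes good: "good P" and inv: "invar P x G" and fn: "v0 \<in> nodes (gr G)" "lab (gr G) v0 = Some (Fn i0)"
  shows "\<exists>H. rstep (grs P) G H"
proof -
  define g where "g = gr G"
  obtain N val rk where s: "sound P N (nodes g) (lab g) (att g) val rk"
    using inv by (auto simp: invar_def g_def)
  obtain v where v: "v \<in> nodes g" "\<exists>i. lab g v = Some (Fn i)"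
    and min: "\<And>u. u \<in> nodes g \<Longrightarrow> \<exists>i. lab g u = Some (Fn i) \<Longrightarrow> rk v \<le> rk u"
    using ex_has_least_nat[of "\<lambda>v. v \<in> nodes g \<and> (\<exists>i. lab g v = Some (Fn i))" v0 rk] fn
    by (auto simp: g_def)
  then obtain i where li: "lab g v = Some (Fn i)" by blast
  have nv: "i < length P" "length (att g v) = nn (P ! i) + ns (P ! i)" "set (att g v) \<subseteq> nodes g"
    "set (take (nn (P ! i)) (att g v)) \<subseteq> N"
    using sound_nodeD[OF s v(1)] li by (auto simp: node_ok_def)
  have child: "\<exists>c. lab g u = Some (Con c) \<and> c \<in> set cs \<and> length (att g u) = ar c" if u: "u \<in> set (att g v)" for u
  proof -
    have un: "u \<in> nodes g" "rk u < rk v" using u nv(3) sound_nodeD[OF s v(1)] by (auto simp: node_ok_def)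
    obtain a where a: "lab g u = Some a" "a \<in> Fsyms (sigof P)" "length (att g u) = sar (sigof P) a"
      using sound_nodeD[OF s un(1)] by (auto simp: node_ok_def)
    then show ?thesis using min[OF un(1)] un(2) by (cases a) auto
  qed
  have "\<exists>args R \<mu>. (args, R) \<in> erules (P ! i) \<and> tm_match g \<mu> (App (Fn i) args)"
  proof (cases "scheme (P ! i)")
    case (Expl R)
    define \<mu> where "\<mu> t = (case t of Var j \<Rightarrow> att g v ! j | App a ts \<Rightarrow> v)" for t :: "'c sym tm"
    have "map \<mu> (map Var [0..<nn (P ! i) + ns (P ! i)]) = att g v"
      using nv(2) by (auto intro!: nth_equalityI simp: \<mu>_def)
    moreover have "att g v ! j \<in> nodes g" if "j < nn (P ! i) + ns (P ! i)" for j
      using nv that by (metis nth_mem subset_iff)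
    ultimately have "tm_match g \<mu> (App (Fn i) (map Var [0..<nn (P ! i) + ns (P ! i)]))"
      using v(1) li by (auto simp: tm_match_def \<mu>_def)
    then show ?thesis using Expl by (auto simp: erules_def)
  next
    case (Cases B)
    then have sh: "nn (P ! i) = 0" "0 < ns (P ! i)" using good_shape[OF good nv(1)] by (auto simp: shape_ok_def)
    define w where "w = hd (att g v)"
    have av: "att g v = w # tl (att g v)" using nv(2) sh by (cases "att g v") (auto simp: w_def)
    then have wv: "w \<in> set (att g v)" by (metis list.set_intros(1))
    then obtain c where c: "lab g w = Some (Con c)" "c \<in> set cs" "length (att g w) = ar c" using child by blast
    have wn: "w \<in> nodes g" using wv nv(3) by auto
    then have wat: "set (att g w) \<subseteq> nodes g" using sound_nodeD[OF s] by (auto simp: node_ok_def)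
    define p where "p = App (Con c) (map Var [0..<ar c])"
    define L where "L = App (Fn i) (p # map Var [ar c..<ar c + (ns (P ! i) - 1)])"
    \<comment> \<open>Only two subterms of the pattern are applications, the root and the
      constructor \<open>p\<close>, and their head symbols tell them apart.\<close>
    define \<mu> where "\<mu> t = (case t of Var j \<Rightarrow> if j < ar c then att g w ! j else tl (att g v) ! (j - ar c)
        | App a ts \<Rightarrow> if a = Fn i then v else w)" for t :: "'c sym tm"
    have lt: "length (tl (att g v)) = ns (P ! i) - 1" using nv(2) sh by simp
    have 1: "map \<mu> (map Var [0..<ar c]) = att g w"
      using c(3) by (auto intro!: nth_equalityI simp: \<mu>_def)
    have "map \<mu> (map Var [ar c..<ar c + (ns (P ! i) - 1)]) = tl (att g v)"
      using lt by (intro nth_equalityI) (auto simp: \<mu>_def)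
    moreover have pw: "\<mu> p = w" by (simp add: p_def \<mu>_def)
    ultimately have 2: "map \<mu> (p # map Var [ar c..<ar c + (ns (P ! i) - 1)]) = att g v"
      using av by simp
    have "set (att g v) = \<mu> ` set (p # map Var [ar c..<ar c + (ns (P ! i) - 1)])"
      using 2 by (metis set_map)
    then have 3: "\<mu> (Var j) \<in> nodes g" if "j \<in> {ar c..<ar c + (ns (P ! i) - 1)}" for j
      using that nv(3) by auto
    have "set (att g w) = \<mu> ` set (map Var [0..<ar c])"
      using 1 by (metis set_map)
    then have 4: "\<mu> (Var j) \<in> nodes g" if "j < ar c" for j
      using that wat by auto
    have "\<mu> L = v" by (simp add: L_def \<mu>_def)
    have "tm_match g \<mu> L"
      unfolding tm_match_def
    proof
      fix t assume "t \<in> subt L"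
      then consider "t = L" | "t = p" | j where "t = Var j" "j < ar c \<or> j \<in> {ar c..<ar c + (ns (P ! i) - 1)}"
        by (auto simp: L_def p_def)
      then show "\<mu> t \<in> nodes g \<and> (\<forall>a ts. t = App a ts \<longrightarrow> lab g (\<mu> t) = Some a \<and> att g (\<mu> t) = map \<mu> ts)"
      proof cases
        case 1
        then show ?thesis using \<open>\<mu> L = v\<close> v(1) li 2 unfolding L_def by auto
      next
        case 2
        then show ?thesis using pw wn c(1) 1 unfolding p_def by auto
      next
        case 3
        then show ?thesis using 4 \<open>\<And>j. j \<in> {ar c..<ar c + (ns (P ! i) - 1)} \<Longrightarrow> \<mu> (Var j) \<in> nodes g\<close> by auto
      qed
    qed
    then show ?thesis using Cases c(2) unfolding L_def p_def erules_def by auto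
  next
    case (Recur h)
    then have sh: "0 < nn (P ! i)" using good_shape[OF good nv(1)] by (auto simp: shape_ok_def)
    define w where "w = hd (att g v)"
    have av: "att g v = w # tl (att g v)" using nv(2) sh by (cases "att g v") (auto simp: w_def)
    \<comment> \<open>The recursion argument is the first one and at least one position is normal,
      so \<open>w\<close> is an input node.\<close>
    have "take (nn (P ! i)) (w # tl (att g v)) = w # take (nn (P ! i) - 1) (tl (att g v))"
      using sh by (cases "nn (P ! i)") auto
    then have wN: "w \<in> N" using nv(4) av by (metis list.set_intros(1) subsetD)
    have N: "N \<subseteq> nodes g" "inj_on val N" using s by (auto simp: sound_def)
    have okw: "gterm_ok cs ar (val w)" using sound_nodeD[OF s] wN N by (auto simp: node_ok_def)
    define m where "m = nn (P ! i) + ns (P ! i) - 1"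
    define L where "L = App (Fn i) (emb (val w) # map Var [0..<m])"
    \<comment> \<open>On subterms of the ground pattern, \<open>\<mu>\<close> sends a term to the
      unique node of \<open>N\<close> having it as value; this is where sharing of the input is
      used.\<close>
    define \<mu> where "\<mu> t = (case t of Var j \<Rightarrow> tl (att g v) ! j
        | App a ts \<Rightarrow> if a = Fn i then v else inv_into N val (inv emb t))" for t :: "'c sym tm"
    have \<mu>emb: "\<mu> (emb (val u)) = u" if "u \<in> N" for u
    proof -
      obtain b ss where "val u = T b ss" by (cases "val u")
      then have "\<mu> (emb (val u)) = inv_into N val (inv emb (emb (val u)))"
        by (simp add: \<mu>_def)
      then show ?thesis using that N(2) by simp
    qed
    have lt: "length (tl (att g v)) = m" using nv(2) by (simp add: m_def)
    then have vars: "map \<mu> (map Var [0..<m]) = tl (att g v)"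
      by (intro nth_equalityI) (auto simp: \<mu>_def)
    have 2: "map \<mu> (emb (val w) # map Var [0..<m]) = att g v"
      using vars \<mu>emb[OF wN] av by simp
    have "set (tl (att g v)) = \<mu> ` set (map Var [0..<m])" using vars by (metis set_map)
    moreover have "set (tl (att g v)) \<subseteq> nodes g" using nv(3) av by (metis set_subset_Cons subset_trans)
    ultimately have 3: "\<mu> (Var j) \<in> nodes g" if "j < m" for j
      using that by auto
    have \<mu>L: "\<mu> L = v" by (simp add: L_def \<mu>_def)
    have "tm_match g \<mu> L"
      unfolding tm_match_def
    proof
      fix t assume "t \<in> subt L"
      then consider "t = L" | "t \<in> subt (emb (val w))" | j where "t = Var j" "j < m"
        by (auto simp: L_def)
      then show "\<mu> t \<in> nodes g \<and> (\<forall>a ts. t = App a ts \<longrightarrow> lab g (\<mu> t) = Some a \<and> att g (\<mu> t) = map \<mu> ts)"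
      proof cases
        case 1
        then show ?thesis using \<mu>L v(1) li 2 unfolding L_def by auto
      next
        case tw: 2
        then obtain u where u: "u \<in> N" "t = emb (val u)" using normal_nodes_emb[OF s wN] by blast
        obtain b where b: "lab g u = Some (Con b)" and sub: "set (att g u) \<subseteq> N"
          using s u(1) by (auto simp: sound_def)
        then have vu: "val u = T b (map val (att g u))"
          using sound_nodeD[OF s subsetD[OF N(1) u(1)]] by (auto simp: node_ok_def)
        then have t: "t = App (Con b) (map emb (map val (att g u)))" using u(2) by simp
        have "map \<mu> (map emb (map val (att g u))) = att g u"
          using sub \<mu>emb by (auto intro!: map_idI)
        then show ?thesis using \<mu>emb[OF u(1)] u N(1) b t by auto
      next
        case 3
        then show ?thesis using \<open>\<And>j. j < m \<Longrightarrow> \<mu> (Var j) \<in> nodes g\<close> by auto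
      qed
    qed
    then show ?thesis using Recur okw unfolding L_def m_def erules_def by auto
  qed
  then obtain args R \<mu> where r: "(args, R) \<in> erules (P ! i)" "tm_match (gr G) \<mu> (App (Fn i) args)"
    unfolding g_def by blast
  have "tm_rule (App (Fn i) args) R \<in> grs P" using r nv(1) by (auto simp: grs_def)
  moreover have "finite (nodes (gr G))" using s by (simp add: sound_def g_def)
  ultimately show ?thesis using rstep_tm_rule_exists r(2) by blast
qed

text \<open>By progress no defined symbol is left, so the value of each node is the term it
  represents, by induction on the rank.\<close>

lemma invar_normal_form:
  assumes "good P" and "invar P x H" and "\<not> (\<exists>H'. rstep (grs P) H H')"
  shows "closed H \<and> over_C (sigof P) H \<and> repr (gr H) (root H) (emb x)"
proof -
  obtain N val rk where s: "sound P N (nodes (gr H)) (lab (gr H)) (att (gr H)) val rk"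
    and r: "root H \<in> nodes (gr H)" "val (root H) = x"
    using assms(2) by (auto simp: invar_def)
  have con: "\<exists>c. lab (gr H) v = Some (Con c) \<and> c \<in> set cs \<and> set (att (gr H) v) \<subseteq> nodes (gr H)
      \<and> val v = T c (map val (att (gr H) v)) \<and> (\<forall>u\<in>set (att (gr H) v). rk u < rk v)" if v: "v \<in> nodes (gr H)" for v
  proof -
    obtain a where a: "lab (gr H) v = Some a" "a \<in> Fsyms (sigof P)" "val v = ap P a (map val (att (gr H) v))"
      using sound_nodeD[OF s v] by (auto simp: node_ok_def)
    then show ?thesis using sound_nodeD[OF s v] progress[OF assms(1,2) v] assms(3)
      by (cases a) (auto simp: node_ok_def)
  qed
  have "repr (gr H) v (emb (val v))" if "v \<in> nodes (gr H)" for v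
    using that
  proof (induction "rk v" arbitrary: v rule: less_induct)
    case less
    obtain c where c: "lab (gr H) v = Some (Con c)" "set (att (gr H) v) \<subseteq> nodes (gr H)"
      "val v = T c (map val (att (gr H) v))" "\<forall>u\<in>set (att (gr H) v). rk u < rk v" using con[OF less.prems] by blast
    have "list_all2 (repr (gr H)) (att (gr H) v) (map emb (map val (att (gr H) v)))"
      using less.hyps c(2,4) by (auto simp: list_all2_conv_all_nth subset_iff)
    then have "repr (gr H) v (App (Con c) (map emb (map val (att (gr H) v))))"
      using less.prems c(1) by (rule rapp[rotated 2])
    then show ?case using c(3) by simp
  qed
  then have "repr (gr H) (root H) (emb x)" using r by blast
  moreover have "closed H" using con by (fastforce simp: closed_def)
  moreover have "over_C (sigof P) H" using con by (fastforce simp: over_C_def)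
  ultimately show ?thesis by blast
qed

section \<open>The initial graph satisfies the invariant\<close>

lemma repr_functional:
  assumes "repr g v s" shows "repr g v t \<Longrightarrow> s = t"
  using assms
proof (induction arbitrary: t rule: repr.induct)
  case (rvar v)
  then show ?case by (auto elim: repr.cases)
next
  case (rapp v a ts)
  from rapp.prems obtain us where us: "t = App a us" "list_all2 (repr g) (att g v) us"
    using rapp.hyps(2) by (auto elim: repr.cases)
  then have "ts = us"
    using rapp.IH by (auto simp: list_all2_conv_all_nth intro!: nth_equalityI)
  then show ?case using us by simp
qed

lemma repr_emb_cases:
  assumes "repr g v (emb t)" and "gterm_ok cs ar t"
  obtains c ts where "t = T c ts" "v \<in> nodes g" "lab g v = Some (Con c)" "c \<in> set cs" "length (att g v) = ar c"
    "list_all2 (\<lambda>u s. repr g u (emb s) \<and> gterm_ok cs ar s) (att g v) ts"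
proof -
  obtain c ts where t: "t = T c ts" by (cases t)
  from assms(1) have "v \<in> nodes g" "lab g v = Some (Con c)" "list_all2 (repr g) (att g v) (map emb ts)"
    unfolding t by (auto elim: repr.cases)
  then show ?thesis using that[OF t] assms(2) t by (auto simp: list_all2_conv_all_nth)
qed

text \<open>As input nodes serve all nodes except the root: being reachable from it, they represent
  ground constructor terms. Their value is the represented term, injective by maximal sharing; the
  root gets the intended result, and the size of the represented term is the rank.\<close>

lemma invar_initial:
  assumes P: "fs < length P" and good: "good P"
    and xs: "vargs cs ar (nn (P ! fs)) xs" and ys: "vargs cs ar (ns (P ! fs)) ys"
    and G: "tgraph_ok (sigof P) G" "max_shared G"
    and rep: "repr (gr G) (root G) (App (Fn fs) (map emb (xs @ ys)))"
  shows "invar P (sem (P ! fs) xs ys) G"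
proof -
  define g where "g = gr G"
  define \<rho> where "\<rho> = root G"
  have rV: "\<rho> \<in> nodes g" and reach: "nodes g = reach g \<rho>" and fin: "finite (nodes g)"
    using G(1) by (auto simp: tgraph_ok_def lgraph_ok_def g_def \<rho>_def)
  have rt: "lab g \<rho> = Some (Fn fs)" "list_all2 (repr g) (att g \<rho>) (map emb (xs @ ys))"
    using rep unfolding g_def \<rho>_def by (auto elim: repr.cases)
  define E where "E = {v. \<exists>t. gterm_ok cs ar t \<and> repr g v (emb t)}"
  have rE: "\<rho> \<notin> E" using rt(1) by (auto simp: E_def elim: repr_emb_cases)
  have attr: "set (att g \<rho>) \<subseteq> E"
  proof
    fix u assume "u \<in> set (att g \<rho>)"
    then obtain j where j: "j < length (att g \<rho>)" "u = att g \<rho> ! j" by (auto simp: in_set_conv_nth)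
    then have "j < length (xs @ ys)" "repr g u (emb ((xs @ ys) ! j))"
      using rt(2) by (auto simp: list_all2_conv_all_nth simp del: map_append)
    moreover from this(1) have "gterm_ok cs ar ((xs @ ys) ! j)"
      using xs ys nth_mem[of j "xs @ ys"] by (auto simp: vargs_def)
    ultimately show "u \<in> E" unfolding E_def by blast
  qed
  have attE: "set (att g v) \<subseteq> E" if vE: "v \<in> E" for v
  proof -
    obtain t where "gterm_ok cs ar t" "repr g v (emb t)" using vE unfolding E_def by blast
    then obtain ts where "list_all2 (\<lambda>u s. repr g u (emb s) \<and> gterm_ok cs ar s) (att g v) ts"
      by (elim repr_emb_cases)
    then show ?thesis
      unfolding E_def list_all2_conv_all_nth by (auto simp only: in_set_conv_nth mem_Collect_eq) blast
  qed
  have "reach g \<rho> \<subseteq> insert \<rho> E"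
    by (rule reach_closed) (use attr attE in auto)
  moreover have EV: "E \<subseteq> nodes g" by (auto simp: E_def elim: repr.cases)
  ultimately have V: "nodes g = insert \<rho> E" using reach rV by auto
  define tv where "tv v = (THE t. repr g v (emb t))" for v
  define val where "val v = (if v = \<rho> then sem (P ! fs) xs ys else tv v)" for v
  define rk where "rk v = size (THE t. repr g v t)" for v
  have valI: "val v = t" if "repr g v (emb t)" "v \<in> E" for v t
  proof -
    have "tv v = t" unfolding tv_def
      using that(1) by (rule the_equality) (use that(1) repr_functional emb_inj in blast)
    then show ?thesis using that(2) rE by (auto simp: val_def)
  qed
  have rkI: "rk v = size t" if "repr g v t" for v t
  proof -
    have "(THE t. repr g v t) = t" using that by (rule the_equality) (use that repr_functional in blast)
    then show ?thesis by (simp add: rk_def)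
  qed
  have rk: "\<forall>u\<in>set (att g v). rk u < rk v" if r: "repr g v t" for v t
  proof (cases rule: repr.cases[OF r])
    case (1 w)
    then have "length (att g v) = 0"
      using G(1) unfolding tgraph_ok_def lgraph_ok_def g_def[symmetric] by force
    then show ?thesis by simp
  next
    case (2 w a ts)
    show ?thesis
    proof
      fix u assume "u \<in> set (att g v)"
      then obtain j where j: "j < length (att g v)" "u = att g v ! j" by (auto simp: in_set_conv_nth)
      then have "repr g u (ts ! j)" "ts ! j \<in> set ts" using 2 by (auto simp: list_all2_conv_all_nth)
      then show "rk u < rk v" using rkI[OF r] rkI 2 size_arg by metis
    qed
  qed
  have nodeE: "node_ok P E (nodes g) (lab g) (att g) val rk v" if vE: "v \<in> E" for v
  proof -
    obtain t where t: "gterm_ok cs ar t" "repr g v (emb t)" using vE unfolding E_def by blast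
    then obtain c ts where c: "t = T c ts" "v \<in> nodes g" "lab g v = Some (Con c)" "c \<in> set cs" "length (att g v) = ar c"
      and l: "list_all2 (\<lambda>u s. repr g u (emb s) \<and> gterm_ok cs ar s) (att g v) ts"
      by (elim repr_emb_cases)
    have "map val (att g v) = ts"
      using l attE[OF vE] valI by (auto simp: list_all2_conv_all_nth subset_iff intro!: nth_equalityI)
    then show ?thesis
      unfolding node_ok_def using c attE[OF vE] EV valI[OF t(2) vE] t(1) rk[OF t(2)] by auto
  qed
  have "map val (att g \<rho>) = xs @ ys"
    using rt(2) attr valI
    by (auto simp: list_all2_conv_all_nth subset_iff intro!: nth_equalityI simp del: map_append)
  moreover have "length (att g \<rho>) = nn (P ! fs) + ns (P ! fs)"
    using rt(2) xs ys by (auto simp: vargs_def dest: list_all2_lengthD)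
  moreover have "gterm_ok cs ar (sem (P ! fs) xs ys)"
    using good_total[OF good P] xs ys by (simp add: total_def)
  moreover have "nn (P ! fs) = length xs" using xs by (simp add: vargs_def)
  moreover have "set (take (nn (P ! fs)) (att g \<rho>)) \<subseteq> E" using attr by (meson in_set_takeD subset_iff)
  ultimately have "node_ok P E (nodes g) (lab g) (att g) val rk \<rho>"
    unfolding node_ok_def using rt(1) P attr EV rk rep by (auto simp: val_def g_def \<rho>_def)
  moreover have "inj_on val E"
  proof (rule inj_onI)
    fix u w assume uw: "u \<in> E" "w \<in> E" "val u = val w"
    then obtain t t' where "repr g u (emb t)" "repr g w (emb t')" unfolding E_def by blast
    then have "repr g u (emb (val u))" "repr g w (emb (val u))" using valI uw by metis+
    then show "u = w" using G(2) uw EV unfolding max_shared_def g_def by blast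
  qed
  moreover have "\<exists>c. lab g v = Some (Con c)" if "v \<in> E" for v
    using that by (auto simp: E_def elim: repr_emb_cases)
  ultimately have "sound P E (nodes g) (lab g) (att g) val rk"
    unfolding sound_def using fin EV nodeE attE V by auto
  moreover have "val \<rho> = sem (P ! fs) xs ys" by (simp add: val_def)
  ultimately show ?thesis
    using rV unfolding invar_def g_def \<rho>_def by blast
qed

lemma grs_computes:
  assumes good: "good P" and P: "fs < length P"
  shows "computes (sigof P) (grs P) (nn (P ! fs)) (ns (P ! fs)) (sem (P ! fs))"
  unfolding computes_def
proof (intro bexI[of _ fs] conjI allI impI)
  fix xs ys G
  assume a: "vargs (cons (sigof P)) (car (sigof P)) (nn (P ! fs)) xs \<and> vargs (cons (sigof P)) (car (sigof P)) (ns (P ! fs)) ys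
        \<and> tgraph_ok (sigof P) G \<and> closed G \<and> basic (sigof P) G \<and> max_shared G
        \<and> repr (gr G) (root G) (App (Fn fs) (map emb (xs @ ys)))"
  let ?x = "sem (P ! fs) xs ys"
  have i: "invar P ?x G" using a by (intro invar_initial[OF P good]) auto
  show "\<not> (\<exists>s. s 0 = G \<and> (\<forall>i. rstep (grs P) (s i) (s (Suc i))))"
  proof
    assume "\<exists>s. s 0 = G \<and> (\<forall>i. rstep (grs P) (s i) (s (Suc i)))"
    then obtain s where s: "s 0 = G" "\<And>i. rstep (grs P) (s i) (s (Suc i))" by blast
    have invs: "invar P ?x (s j)" for j
      by (induction j) (use i s rstep_preserves(1)[OF good] in auto)
    have "(fmset (lab (gr (s (Suc j)))) (nodes (gr (s (Suc j)))), fmset (lab (gr (s j))) (nodes (gr (s j)))) \<in> mult less_than" for j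
      using rstep_preserves(2)[OF good invs s(2)] .
    moreover have "wf (mult less_than)" by (simp add: wf_mult)
    ultimately show False
      unfolding wf_iff_no_infinite_down_chain
      by (elim notE) (rule exI[of _ "\<lambda>j. fmset (lab (gr (s j))) (nodes (gr (s j)))"], blast)
  qed
  fix H
  assume H: "(rstep (grs P))\<^sup>*\<^sup>* G H \<and> \<not> (\<exists>H'. rstep (grs P) H H')"
  then have "(rstep (grs P))\<^sup>*\<^sup>* G H" by blast
  then have "invar P ?x H"
    by induction (use i rstep_preserves(1)[OF good] in auto)
  then show "closed H" "over_C (sigof P) H" "repr (gr H) (root H) (emb ?x)"
    using invar_normal_form[OF good] H by blast+
qed (use P in auto)

section \<open>Shape, precedence and size of the rules\<close>

lemma wft_lhs:
  assumes "trule_ok P i args R"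
  shows "wft (sigof P) (App (Fn i) args)"
  using assms by (auto simp: trule_ok_def)

lemma constructor_grs_grs:
  assumes "good P"
  shows "constructor_grs (sigof P) (grs P)"
  unfolding constructor_grs_def
proof
  fix r assume "r \<in> grs P"
  then obtain i args R where r: "r = tm_rule (App (Fn i) args) R" and i: "i < length P" and ok: "trule_ok P i args R"
    using good_rule[OF assms] by (auto simp: grs_def)
  have "App (Fn i) args \<noteq> R" using ok unfolding trule_ok_def by (metis less_irrefl subt_refl)
  moreover have "Var x \<in> subt (App (Fn i) args)" if "Var x \<in> subt R" for x
    using ok that by (auto simp: trule_ok_def)
  ultimately have "rule_ok (sigof P) r"
    unfolding r using ok wft_lhs by (intro rule_ok_tm_rule) (auto simp: trule_ok_def simp del: subt.simps)
  moreover have "basic (sigof P) (lhsG r)"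
    unfolding r using ok i by (intro basic_tm_rule) (auto simp: trule_ok_def)
  ultimately show "rule_ok (sigof P) r \<and> basic (sigof P) (lhsG r)" by blast
qed

text \<open>The precedence is the order of definition in the program; the shift by
  \<open>Suc\<close> leaves rank 0 to the constructors, which makes them minimal.\<close>

fun rank :: "'c sym \<Rightarrow> nat" where
  "rank (Con c) = 0"
| "rank (Fn i) = Suc i"

lemma pt_sep_grs:
  assumes "good P"
  shows "pt_sep (sigof P) (grs P)"
proof -
  let ?Q = "measure rank :: 'c sym rel"
  have "pt (sigof P) ?Q (rhsG r) (lhsG r)" if r: "r \<in> grs P" for r
  proof -
    obtain i args R where r: "r = tm_rule (App (Fn i) args) R" and ok: "trule_ok P i args R"
      using good_rule[OF assms] r by (auto simp: grs_def)
    have "(a, Fn i) \<in> ?Q" if "App a ts \<in> subt R" for a ts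
      using ok that by (cases a) (auto simp: trule_ok_def)
    moreover have "pt_tm (sigof P) (snn (sigof P) (Fn i)) args R" using ok by (simp add: trule_ok_def)
    ultimately show ?thesis
      unfolding r lhsG_tm_rule rhsG_tm_rule by (intro pt_tgt rule_enc_inj_lhs rule_enc_inj_rhs)
  qed
  moreover have "precedence ?Q"
    by (auto simp: precedence_def intro!: transI)
  ultimately show ?thesis unfolding pt_sep_def by blast
qed

text \<open>The first set has one unfolding for each distinct subterm of the argument. Writing it as
  an image of \<open>subt (emb (T c ts))\<close> bounds its cardinality by the number of nodes of
  the shared argument.\<close>

lemma subt_unfolding_tm:
  "subt (unfolding_tm h m (T c ts)) \<subseteq> (unfolding_tm h m \<circ> inv emb) ` subt (emb (T c ts))
     \<union> (\<Union>u\<in>set ts. subt (emb u)) \<union> Var ` {..<m}"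
proof (induction "T c ts" arbitrary: c ts)
  case (T c ts)
  let ?X = "(unfolding_tm h m \<circ> inv emb) ` subt (emb (T c ts))"
  have "unfolding_tm h m (T c ts) = (unfolding_tm h m \<circ> inv emb) (emb (T c ts))"
    by (simp only: comp_def inv_emb)
  then have 1: "unfolding_tm h m (T c ts) \<in> ?X" using subt_refl by (metis imageI)
  have 2: "subt (unfolding_tm h m u) \<subseteq> ?X \<union> (\<Union>u\<in>set ts. subt (emb u)) \<union> Var ` {..<m}" if u: "u \<in> set ts" for u
  proof -
    obtain b us where ub: "u = T b us" by (cases u)
    have X: "subt (emb u) \<subseteq> subt (emb (T c ts))" using u by auto
    have "(\<Union>w\<in>set us. subt (emb w)) \<subseteq> subt (emb u)" using ub by auto
    then have "(\<Union>w\<in>set us. subt (emb w)) \<subseteq> (\<Union>u\<in>set ts. subt (emb u))" using u by blast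
    moreover have "(unfolding_tm h m \<circ> inv emb) ` subt (emb (T b us)) \<subseteq> ?X"
      using X unfolding ub by (rule image_mono)
    ultimately show ?thesis
      unfolding ub by (intro subset_trans[OF T[OF u[unfolded ub]]] Un_mono order_refl)
  qed
  have "subt (unfolding_tm h m (T c ts)) \<subseteq> insert (unfolding_tm h m (T c ts))
     ((\<Union>u\<in>set ts. subt (emb u)) \<union> Var ` {..<m} \<union> (\<Union>u\<in>set ts. subt (unfolding_tm h m u)))"
    by auto
  then show ?case using 1 2 by blast
qed

text \<open>For (iv) the right-hand nodes are charged in three groups: unfoldings to the nodes of
  \<open>t\<close> on the left, variables to the same variables on the left, and proper subterms of
  \<open>t\<close> to the nodes below normal arguments of the right root. For (iii) only the
  \<open>m\<close> variables are counted.\<close>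

lemma inf_rule_conds_Recur:
  assumes good: "good P" and i: "i < length P" and h: "scheme (P ! i) = Recur h"
    and t: "gterm_ok cs ar t" and d: "nn (P ! i) + ns (P ! i) \<le> d"
  shows "inf_rule_conds (sigof P) d (tm_rule (App (Fn i) (emb t # map Var [0..<nn (P ! i) + ns (P ! i) - 1]))
      (unfolding_tm h (nn (P ! i) + ns (P ! i) - 1) t))"
proof -
  define m where "m = nn (P ! i) + ns (P ! i) - 1"
  define args where "args = emb t # map Var [0..<m]"
  define L where "L = App (Fn i) args"
  define R where "R = unfolding_tm h m t"
  define K where "K = rg (tm_rule L R)"
  define e where "e = rule_enc L R"
  define S where "S = sigof P"
  obtain c ts where tc: "t = T c ts" by (cases t)
  have sh: "0 < nn (P ! i)" "nn (P ! h c) = ar c + (nn (P ! i) - 1)"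
    using good_shape[OF good i] h t tc by (auto simp: shape_ok_def)
  have injL: "inj_on e (subt L)" and injR: "inj_on e (subt R)" and inj: "inj_on e (subt L \<union> subt R)"
    unfolding e_def by (rule rule_enc_inj_lhs rule_enc_inj_rhs rule_enc_inj)+
  have labK: "lab K (e s) = tlab s" "att K (e s) = map e (targs s)" "restr K (e s) = tgt e s" "reach K (e s) = e ` subt s"
    if "s \<in> subt L \<union> subt R" for s
    using that unfolding K_def e_def by (rule lab_tm_rule att_tm_rule restr_tm_rule reach_tm_rule)+
  have snL: "snn S (Fn i) = nn (P ! i)" by (simp add: S_def)
  have nrmL: "nrm S K (e L) = map e (take (nn (P ! i)) args)" "safe S K (e L) = map e (drop (nn (P ! i)) args)"
    using labK(1,2)[of L] snL by (auto simp: nrm_def safe_def L_def take_map drop_map)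
  have argL: "s \<in> subt L" if "s \<in> set args" for s using that arg_subt by (simp add: L_def)
  have drop: "s \<in> Var ` {..<m}" if "s \<in> set (drop (nn (P ! i)) args)" for s
  proof -
    have "drop (nn (P ! i)) args = drop (nn (P ! i) - 1) (map Var [0..<m])"
      using sh(1) by (cases "nn (P ! i)") (auto simp: args_def)
    then have "s \<in> set (map Var [0..<m])" using that by (metis in_set_dropD)
    then show ?thesis by auto
  qed
  have "safe S (gr (tgt e L)) (e L) = map e (drop (nn (P ! i)) args)"
    using nrm_tgt(2)[of e "Fn i" args S] injL snL by (simp add: L_def)
  moreover have "lab (gr (tgt e L)) (e s) = None" if "s \<in> set (drop (nn (P ! i)) args)" for s
    using that drop argL injL by (fastforce dest: in_set_dropD)
  \<comment> \<open>All safe successors of the left root are variables, so \<open>cap_nrm\<close>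
    changes nothing and sharing of the whole left-hand side gives (i).\<close>
  ultimately have "cap_nrm S (tgt e L) = tgt e L"
    by (auto simp: cap_nrm_def Let_def)
  then have 1: "max_shared (cap_nrm S (restr K (e L)))"
    using labK(3)[of L] max_shared_tgt[OF injL] by simp
  have 2: "closed (restr K v)" if v: "v \<in> set (nrm S K (e L))" "lab K v \<noteq> None" for v
  proof -
    obtain s where s: "s \<in> set args" "v = e s" using v(1) nrmL by (auto dest: in_set_takeD)
    then have "s = emb t" using v(2) labK(1)[of s] argL by (auto simp: args_def)
    moreover have injt: "inj_on e (subt (emb t))"
      using injL inj_on_subset subt_trans argL by (metis args_def list.set_intros(1))
    moreover have "tlab u \<noteq> None" if u: "u \<in> subt (emb t)" for u
    proof -
      obtain w where "u = emb w" using subt_emb_Con u by blast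
      then show ?thesis by (cases w) auto
    qed
    ultimately show ?thesis
      using s argL labK(3)[of s] by (auto simp: closed_def)
  qed
  have "{v\<in>set (nrm S K (e L)). lab K v = None} \<union> (\<Union>v\<in>set (safe S K (e L)). reach K v) \<subseteq> e ` Var ` {..<m}"
  proof (intro Un_least subsetI)
    fix v assume "v \<in> {v\<in>set (nrm S K (e L)). lab K v = None}"
    then obtain s where s: "s \<in> set args" "v = e s" "lab K v = None" using nrmL by (auto dest: in_set_takeD)
    then have "tlab s = None" using labK(1)[of s] argL by auto
    then have "s \<in> Var ` {..<m}" using s(1) by (cases t) (auto simp: args_def)
    then show "v \<in> e ` Var ` {..<m}" using s by blast
  next
    fix v assume "v \<in> (\<Union>v\<in>set (safe S K (e L)). reach K v)"
    then obtain s where s: "s \<in> set (drop (nn (P ! i)) args)" "v \<in> reach K (e s)" using nrmL by auto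
    then have "s \<in> set args" by (auto dest: in_set_dropD)
    then have "v \<in> e ` subt s" using s(2) labK(4)[of s] argL by auto
    then show "v \<in> e ` Var ` {..<m}" using drop[OF s(1)] by auto
  qed
  then have "card ({v\<in>set (nrm S K (e L)). lab K v = None} \<union> (\<Union>v\<in>set (safe S K (e L)). reach K v))
      \<le> card (e ` Var ` {..<m})"
    by (intro card_mono) auto
  also have "\<dots> \<le> m"
    by (metis card_image_le card_lessThan finite_imageI finite_lessThan le_trans)
  also have "\<dots> \<le> d" using d by (simp add: m_def)
  finally have 3: "card ({v\<in>set (nrm S K (e L)). lab K v = None} \<union> (\<Union>v\<in>set (safe S K (e L)). reach K v)) \<le> d" .

  define Y where "Y = (\<Union>u\<in>set ts. subt (emb u))"
  have Rc: "R = App (Fn (h c)) (map emb ts @ map Var [0..<m] @ map (unfolding_tm h m) ts)"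
    by (simp add: R_def tc)
  have "nrm S K (e R) = map e (take (nn (P ! h c)) (map emb ts @ map Var [0..<m] @ map (unfolding_tm h m) ts))"
    using labK(1,2)[of R] by (simp add: nrm_def Rc S_def take_map)
  moreover have "length ts = ar c" using t tc by simp
  ultimately have nrmR: "e (emb u) \<in> set (nrm S K (e R))" if "u \<in> set ts" for u
    using that sh(2) by auto
  have "reach K (e (emb u)) = e ` subt (emb u)" if "u \<in> set ts" for u
  proof -
    have "emb u \<in> subt R" unfolding Rc using that by (intro arg_subt) auto
    then show ?thesis using labK(4) by blast
  qed
  then have YN: "e ` Y \<subseteq> (\<Union>v\<in>set (nrm S K (e R)). reach K v)"
    using nrmR unfolding Y_def by blast
  \<comment> \<open>This inclusion is wanted for finiteness: without it \<open>card\<close> could be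
    0 and monotonicity would fail.\<close>
  have "(\<Union>v\<in>set (nrm S K (e R)). reach K v) \<subseteq> reach K (e R)"
  proof -
    have "v \<in> set (att K (e R))" if "v \<in> set (nrm S K (e R))" for v
      using that labK(1)[of R] by (auto simp: nrm_def Rc dest: in_set_takeD)
    then have "v \<in> e ` subt R" if "v \<in> set (nrm S K (e R))" for v
      using that labK(2)[of R] targs_subt by fastforce
    then show ?thesis
      using labK(4) subt_trans by fastforce
  qed
  moreover have "finite (reach K (e R))" using labK(4)[of R] by simp
  ultimately have fin: "finite (\<Union>v\<in>set (nrm S K (e R)). reach K v)" using finite_subset by blast
  have Ysub: "Y \<subseteq> subt R"
    unfolding Y_def Rc by auto
  have "card Y = card (e ` Y)"
    using card_image[OF inj_on_subset[OF injR Ysub]] by simp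
  also have "\<dots> \<le> card (\<Union>v\<in>set (nrm S K (e R)). reach K v)" using YN fin by (rule card_mono[rotated])
  finally have cY: "card Y \<le> card (\<Union>v\<in>set (nrm S K (e R)). reach K v)" .
  have finY: "finite Y" by (simp add: Y_def)
  have "subt R \<subseteq> (unfolding_tm h m \<circ> inv emb) ` subt (emb t) \<union> Y \<union> Var ` {..<m}"
    using subt_unfolding_tm[of h m c ts] by (simp only: R_def tc Y_def)
  then have "card (subt R) \<le> card ((unfolding_tm h m \<circ> inv emb) ` subt (emb t) \<union> Y \<union> Var ` {..<m})"
    using finY by (intro card_mono) auto
  also have "\<dots> \<le> card ((unfolding_tm h m \<circ> inv emb) ` subt (emb t)) + card Y + card (Var ` {..<m} :: 'c sym tm set)"
    by (meson add_le_mono card_Un_le le_refl le_trans)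
  also have "\<dots> \<le> card (subt (emb t)) + card Y + card (Var ` {..<m} :: 'c sym tm set)"
    by (intro add_mono card_image_le) auto
  finally have cR: "card (subt R) \<le> card (subt (emb t)) + card Y + card (Var ` {..<m} :: 'c sym tm set)" .
  have "subt (emb t) \<inter> Var ` {..<m} = {}"
  proof -
    have "s \<notin> range Var" if "s \<in> subt (emb t)" for s
    proof -
      obtain w where "s = emb w" using subt_emb_Con \<open>s \<in> subt (emb t)\<close> by blast
      then show ?thesis by (cases w) auto
    qed
    then show ?thesis by blast
  qed
  then have "card (subt (emb t)) + card (Var ` {..<m} :: 'c sym tm set) = card (subt (emb t) \<union> Var ` {..<m})"
    by (intro card_Un_disjoint[symmetric]) auto
  also have "\<dots> \<le> card (subt L)"
    by (intro card_mono) (auto simp: L_def args_def)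
  finally have "card (subt R) \<le> card (subt L) + card (\<Union>v\<in>set (nrm S K (e R)). reach K v)"
    using cR cY by linarith
  then have 4: "gsize (restr K (e R)) \<le> gsize (restr K (e L)) + card (\<Union>v\<in>set (nrm S K (e R)). reach K v)"
    using labK(3)[of L] labK(3)[of R] card_image[OF injL] card_image[OF injR] by (simp add: gsize_def)
  have "inf_rule_conds S d (tm_rule L R)"
    unfolding inf_rule_conds_def Let_def lhs_tm_rule rhs_tm_rule K_def[symmetric] e_def[symmetric]
    using 1 2 3 4 by blast
  then show ?thesis by (simp add: S_def L_def R_def args_def m_def)
qed

text \<open>\<open>Gfin\<close> is a finite union of finite sets, one per program index, so
  \<open>d\<close> can be the maximum of the arities and of its right-hand sizes. Infinitely many
  rules for one symbol can only come from \<open>Recur\<close>; a recursion with finitely many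
  ground arguments falls under \<open>Gfin\<close>. The arity part of \<open>d\<close> supplies
  (iii).\<close>

lemma grs_bounds:
  assumes good: "good P"
  shows "\<exists>d. (\<forall>g\<in>Fsyms (sigof P). sar (sigof P) g \<le> d) \<and> (\<forall>R\<in>Gfin (grs P). gsize (rhsG R) \<le> d)
    \<and> (\<forall>R\<in>Ginf (grs P). inf_rule_conds (sigof P) d R)"
proof -
  have root: "lab (rg (tm_rule (App (Fn i) args) R)) (lhs (tm_rule (App (Fn i) args) R)) = Some (Fn i)"
    for i R and args :: "'c sym tm list"
    using lab_tm_rule[of "App (Fn i) args" "App (Fn i) args" R] by (simp add: lhs_tm_rule)
  have "Gfin (grs P) \<subseteq> (\<Union>i\<in>{i. i < length P \<and> Fn i \<notin> Dinf (grs P)}. {R\<in>grs P. lab (rg R) (lhs R) = Some (Fn i)})"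
  proof
    fix r assume r: "r \<in> Gfin (grs P)"
    then have "r \<in> grs P" by (simp add: Gfin_def)
    then obtain i args R where i: "i < length P" "r = tm_rule (App (Fn i) args) R" by (auto simp: grs_def)
    then have "lab (rg r) (lhs r) = Some (Fn i)" using root by simp
    then show "r \<in> (\<Union>i\<in>{i. i < length P \<and> Fn i \<notin> Dinf (grs P)}. {R\<in>grs P. lab (rg R) (lhs R) = Some (Fn i)})"
      using r i(1) by (auto simp: Gfin_def Ginf_def)
  qed
  moreover have "finite (\<Union>i\<in>{i. i < length P \<and> Fn i \<notin> Dinf (grs P)}. {R\<in>grs P. lab (rg R) (lhs R) = Some (Fn i)})"
    by (auto simp: Dinf_def)
  ultimately have fin: "finite (Gfin (grs P))" by (rule finite_subset)
  have finF: "finite (Fsyms (sigof P))" by (simp add: Fsyms_def)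
  define d where "d = Max (insert 0 (sar (sigof P) ` Fsyms (sigof P) \<union> (\<lambda>R. gsize (rhsG R)) ` Gfin (grs P)))"
  have dF: "sar (sigof P) g \<le> d" if "g \<in> Fsyms (sigof P)" for g
    unfolding d_def using that fin finF by (intro Max_ge) auto
  have dG: "gsize (rhsG R) \<le> d" if "R \<in> Gfin (grs P)" for R
    unfolding d_def using that fin finF by (intro Max_ge) auto
  have "inf_rule_conds (sigof P) d r" if r: "r \<in> Ginf (grs P)" for r
  proof -
    obtain i args R where i: "i < length P" "(args, R) \<in> erules (P ! i)" and req: "r = tm_rule (App (Fn i) args) R"
      using r by (auto simp: Ginf_def grs_def)
    have inf: "infinite {r\<in>grs P. lab (rg r) (lhs r) = Some (Fn i)}"
      using r root[of i args R] unfolding req Ginf_def Dinf_def by auto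
    have "{r\<in>grs P. lab (rg r) (lhs r) = Some (Fn i)} \<subseteq> (\<lambda>(args, R). tm_rule (App (Fn i) args) R) ` erules (P ! i)"
      using root by (auto simp: grs_def)
    then have infe: "infinite (erules (P ! i))" using inf finite_surj by blast
    then obtain h where h: "scheme (P ! i) = Recur h"
      by (cases "scheme (P ! i)") (auto simp: erules_def)
    then obtain t where t: "gterm_ok cs ar t" "args = emb t # map Var [0..<nn (P ! i) + ns (P ! i) - 1]"
      "R = unfolding_tm h (nn (P ! i) + ns (P ! i) - 1) t"
      using i(2) by (auto simp: erules_def)
    have "nn (P ! i) + ns (P ! i) \<le> d" using dF[of "Fn i"] i(1) by simp
    then show ?thesis unfolding req t(2,3) by (intro inf_rule_conds_Recur[OF good i(1) h t(1)])
  qed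
  then show ?thesis using dF dG by blast
qed

end

section \<open>Programs for general safe recursive functions\<close>

context constructors
begin

section \<open>Extending a program leaves its earlier entries intact\<close>

lemma sym_append:
  assumes "a \<in> Fsyms (sigof P)"
  shows "a \<in> Fsyms (sigof (P @ Q))" "sar (sigof (P @ Q)) a = sar (sigof P) a"
    "snn (sigof (P @ Q)) a = snn (sigof P) a" "ap (P @ Q) a = ap P a"
  using assms by (cases a; auto simp: nth_append fun_eq_iff)+

lemma wft_append: "wft (sigof P) t \<Longrightarrow> wft (sigof (P @ Q)) t"
  by (induction t) (auto simp: sym_append)

lemma eval_append: "wft (sigof P) t \<Longrightarrow> eval (P @ Q) \<sigma> t = eval P \<sigma> t"
proof (induction t)
  case (App a ts)
  then have "map (eval (P @ Q) \<sigma>) ts = map (eval P \<sigma>) ts" by auto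
  then show ?case using App.prems by (simp add: sym_append del: map_eq_conv)
qed simp

lemma pt_tm_append:
  assumes "pt_tm (sigof P) k args R"
  shows "wft (sigof P) R \<Longrightarrow> pt_tm (sigof (P @ Q)) k args R"
  using assms
proof (induction rule: pt_tm.induct)
  case (pt_app a ts)
  have a: "snn (sigof (P @ Q)) a = snn (sigof P) a" using pt_app.prems by (simp add: sym_append)
  show ?case
    by (rule pt_tm.pt_app) (use pt_app a in \<open>auto dest: in_set_dropD\<close>)
qed (auto intro: pt_tm.intros)

lemma trule_ok_append:
  assumes ok: "trule_ok P i args R"
  shows "trule_ok (P @ Q) i args R"
proof -
  have i: "(P @ Q) ! i = P ! i" "i < length P" using ok by (auto simp: trule_ok_def nth_append)
  have "map (eval (P @ Q) \<sigma>) args = map (eval P \<sigma>) args" "eval (P @ Q) \<sigma> R = eval P \<sigma> R" for \<sigma>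
    using ok by (auto simp: trule_ok_def eval_append)
  moreover have "ap (P @ Q) (Fn i) = ap P (Fn i)" using i by (simp add: sym_append)
  moreover have "pt_tm (sigof (P @ Q)) (nn (P ! i)) args R" using ok by (simp add: trule_ok_def pt_tm_append)
  ultimately show ?thesis
    using ok unfolding trule_ok_def i by (simp add: wft_append del: map_eq_conv ap.simps)
qed

text \<open>The conditions on a rule of an entry about to be appended. Both sides are terms over the
  old program, so all defined symbols on the right automatically precede the new one.\<close>

definition new_rule_ok :: "'c entry list \<Rightarrow> 'c entry \<Rightarrow> 'c sym tm list \<Rightarrow> 'c sym tm \<Rightarrow> bool" where
  "new_rule_ok P E args R \<longleftrightarrow> length args = nn E + ns E
    \<and> (\<forall>t\<in>set args. wft (sigof P) t \<and> (\<forall>a ts. App a ts \<in> subt t \<longrightarrow> a \<in> Con ` set cs))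
    \<and> wft (sigof P) R
    \<and> (\<forall>x. Var x \<in> subt R \<longrightarrow> (\<exists>t\<in>set args. Var x \<in> subt t))
    \<and> pt_tm (sigof P) (nn E) args R
    \<and> (\<forall>\<sigma>. (\<forall>x. \<forall>t\<in>set args. Var x \<in> subt t \<longrightarrow> gterm_ok cs ar (\<sigma> x)) \<longrightarrow>
         sem E (take (nn E) (map (eval P \<sigma>) args)) (drop (nn E) (map (eval P \<sigma>) args)) = eval P \<sigma> R)"

lemma trule_ok_new:
  assumes ok: "new_rule_ok P E args R"
  shows "trule_ok (P @ [E]) (length P) args R"
proof -
  have "map (eval (P @ [E]) \<sigma>) args = map (eval P \<sigma>) args" "eval (P @ [E]) \<sigma> R = eval P \<sigma> R" for \<sigma>
    using ok by (auto simp: new_rule_ok_def eval_append)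
  moreover have "pt_tm (sigof (P @ [E])) (nn E) args R" using ok by (simp add: new_rule_ok_def pt_tm_append)
  moreover have "j < length P" if "App (Fn j) ts \<in> subt R" for j ts
    using ok wft_subt[OF _ that, of "sigof P"] by (simp add: new_rule_ok_def)
  ultimately show ?thesis
    using ok unfolding trule_ok_def new_rule_ok_def by (simp add: wft_append del: map_eq_conv)
qed

definition realizes :: "'c entry list \<Rightarrow> nat \<Rightarrow> nat \<Rightarrow> ('c gterm list \<Rightarrow> 'c gterm list \<Rightarrow> 'c gterm) \<Rightarrow> nat \<Rightarrow> bool" where
  "realizes P k l f i \<longleftrightarrow> i < length P \<and> nn (P ! i) = k \<and> ns (P ! i) = l \<and> sem (P ! i) = f"

text \<open>Quantifying over every starting program lets several functions be realized one after
  another in a common program, as composition and recursion require.\<close>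

definition realizable :: "nat \<Rightarrow> nat \<Rightarrow> ('c gterm list \<Rightarrow> 'c gterm list \<Rightarrow> 'c gterm) \<Rightarrow> bool" where
  "realizable k l f \<longleftrightarrow> (\<forall>P. good P \<longrightarrow> (\<exists>Q i. good (P @ Q) \<and> realizes (P @ Q) k l f i))"

lemma realizes_append: "realizes P k l f i \<Longrightarrow> realizes (P @ Q) k l f i"
  by (simp add: realizes_def nth_append)

lemma shape_ok_append: "shape_ok P E \<Longrightarrow> shape_ok (P @ Q) E"
  by (auto simp: shape_ok_def nth_append split: scheme.splits)

lemma add_entry:
  assumes "good P" and "total E" and "shape_ok P E"
    and "\<And>args R. (args, R) \<in> erules E \<Longrightarrow> new_rule_ok P E args R"
  shows "good (P @ [E]) \<and> realizes (P @ [E]) (nn E) (ns E) (sem E) (length P)"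
proof -
  have "shape_ok (P @ [E]) ((P @ [E]) ! i) \<and> total ((P @ [E]) ! i)
     \<and> (\<forall>(args, R)\<in>erules ((P @ [E]) ! i). trule_ok (P @ [E]) i args R)" if "i < length (P @ [E])" for i
  proof (cases "i < length P")
    case True
    then have "(P @ [E]) ! i = P ! i" by (simp add: nth_append)
    then show ?thesis
      using good_shape[OF assms(1) True] good_total[OF assms(1) True] good_rule[OF assms(1) True]
      by (auto intro: shape_ok_append trule_ok_append)
  next
    case False
    then have "i = length P" using that by simp
    then show ?thesis using assms(2-4) by (auto intro: shape_ok_append trule_ok_new)
  qed
  then show ?thesis by (simp add: good_def realizes_def)
qed

lemma realize_list:
  assumes "\<forall>(k, l, f)\<in>set Fs. realizable k l f" and "good P"
  shows "\<exists>Q is. good (P @ Q) \<and> list_all2 (\<lambda>(k, l, f) i. realizes (P @ Q) k l f i) Fs is"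
  using assms(1)
proof (induction Fs rule: rev_induct)
  case Nil
  then show ?case using assms(2) by (intro exI[of _ "[]"]) auto
next
  case (snoc F Fs)
  then obtain Q "is" where Q: "good (P @ Q)" "list_all2 (\<lambda>(k, l, f) i. realizes (P @ Q) k l f i) Fs is" by auto
  obtain k l f where F: "F = (k, l, f)" by (cases F)
  then have "realizable k l f" using snoc.prems by auto
  then obtain Q' j where Q': "good ((P @ Q) @ Q')" "realizes ((P @ Q) @ Q') k l f j"
    using Q(1) unfolding realizable_def by blast
  have "list_all2 (\<lambda>(k, l, f) i. realizes ((P @ Q) @ Q') k l f i) Fs is"
    using Q(2) by (rule list_all2_mono) (auto simp del: append_assoc intro: realizes_append)
  then have "list_all2 (\<lambda>(k, l, f) i. realizes (P @ (Q @ Q')) k l f i) (Fs @ [F]) (is @ [j])"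
    using Q'(2) F by (auto intro!: list_all2_appendI)
  then show ?case using Q'(1) by (intro exI[of _ "Q @ Q'"] exI[of _ "is @ [j]"]) auto
qed

lemma good_eval_ok:
  assumes "good P" and "wft (sigof P) t" and "\<And>x. Var x \<in> subt t \<Longrightarrow> gterm_ok cs ar (\<sigma> x)"
  shows "gterm_ok cs ar (eval P \<sigma> t)"
  using assms good_total by (intro gterm_ok_eval) auto

text \<open>That \<open>f\<close> maps valid inputs to valid outputs is not assumed:
  \<open>f\<close> agrees with the evaluation of \<open>R\<close>, and well-formed terms over a good
  program evaluate to valid terms. The same argument serves the other two schemes.\<close>

lemma add_Expl:
  assumes good: "good P" and R: "wft (sigof P) R" and vars: "\<And>x. Var x \<in> subt R \<Longrightarrow> x < k + l"
    and pt: "pt_tm (sigof P) k (map Var [0..<k + l]) R"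
    and sem: "\<And>\<sigma>. (\<And>x. x < k + l \<Longrightarrow> gterm_ok cs ar (\<sigma> x)) \<Longrightarrow> f (map \<sigma> [0..<k]) (map \<sigma> [k..<k + l]) = eval P \<sigma> R"
  shows "\<exists>Q i. good (P @ Q) \<and> realizes (P @ Q) k l f i"
proof -
  let ?E = "Entry k l f (Expl R)"
  have "total ?E"
    unfolding total_def
  proof (intro allI impI)
    fix xs ys assume "vargs cs ar (nn ?E) xs \<and> vargs cs ar (ns ?E) ys"
    then have v: "vargs cs ar k xs" "vargs cs ar l ys" by auto
    let ?\<sigma> = "\<lambda>x. (xs @ ys) ! x"
    have ok: "gterm_ok cs ar (?\<sigma> x)" if "x < k + l" for x
      using v that nth_mem[of x "xs @ ys"] by (auto simp: vargs_def)
    have "map ?\<sigma> [0..<k] = xs" "map ?\<sigma> [k..<k + l] = ys"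
      using v by (auto simp: vargs_def nth_append intro!: nth_equalityI)
    then have "f xs ys = eval P ?\<sigma> R" using sem[of ?\<sigma>] ok by simp
    then show "gterm_ok cs ar (sem ?E xs ys)" using good_eval_ok[OF good R, of ?\<sigma>] vars ok by simp
  qed
  moreover have "new_rule_ok P ?E args R'" if mem: "(args, R') \<in> erules ?E" for args R'
  proof -
    have ar: "args = map Var [0..<k + l]" "R' = R" using mem by (auto simp: erules_def)
    have "map (eval P \<sigma>) args = map \<sigma> [0..<k] @ map \<sigma> [k..<k + l]" for \<sigma>
      unfolding ar(1) by (simp add: upt_add_eq_append[of 0 k l, simplified] del: upt_Suc)
    then show ?thesis
      using R vars pt sem unfolding new_rule_ok_def by (auto simp: ar)
  qed
  ultimately show ?thesis
    using add_entry[OF good, of ?E] by (auto simp: shape_ok_def)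
qed

lemma add_Cases:
  assumes good: "good P" and R: "\<And>c. c \<in> set cs \<Longrightarrow> wft (sigof P) (B c)"
    and vars: "\<And>c x. c \<in> set cs \<Longrightarrow> Var x \<in> subt (B c) \<Longrightarrow> x < ar c + l"
    and pt: "\<And>c. c \<in> set cs \<Longrightarrow> pt_tm (sigof P) 0 (App (Con c) (map Var [0..<ar c]) # map Var [ar c..<ar c + l]) (B c)"
    and sem: "\<And>c \<sigma>. c \<in> set cs \<Longrightarrow> (\<And>x. x < ar c + l \<Longrightarrow> gterm_ok cs ar (\<sigma> x)) \<Longrightarrow>
       f [] (T c (map \<sigma> [0..<ar c]) # map \<sigma> [ar c..<ar c + l]) = eval P \<sigma> (B c)"
  shows "\<exists>Q i. good (P @ Q) \<and> realizes (P @ Q) 0 (Suc l) f i"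
proof -
  let ?E = "Entry 0 (Suc l) f (Cases B)"
  have "total ?E"
    unfolding total_def
  proof (intro allI impI)
    fix xs ys assume "vargs cs ar (nn ?E) xs \<and> vargs cs ar (ns ?E) ys"
    then have v: "xs = []" "vargs cs ar (Suc l) ys" by (auto simp: vargs_def)
    then obtain c ts zs where ys: "ys = T c ts # zs" by (cases ys; cases "hd ys") (auto simp: vargs_def)
    then have c: "c \<in> set cs" "length ts = ar c" "length zs = l" using v by (auto simp: vargs_def)
    let ?\<sigma> = "\<lambda>x. (ts @ zs) ! x"
    have ok: "gterm_ok cs ar (?\<sigma> x)" if "x < ar c + l" for x
      using v ys c that nth_mem[of x "ts @ zs"] by (auto simp: vargs_def)
    have "map ?\<sigma> [0..<ar c] = ts" "map ?\<sigma> [ar c..<ar c + l] = zs"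
      using c by (auto simp: nth_append intro!: nth_equalityI)
    then have "f [] ys = eval P ?\<sigma> (B c)" using sem[OF c(1), of ?\<sigma>] ok ys by simp
    then show "gterm_ok cs ar (sem ?E xs ys)"
      using good_eval_ok[OF good R[OF c(1)], of ?\<sigma>] vars[OF c(1)] ok v by simp
  qed
  moreover have "new_rule_ok P ?E args R'" if mem: "(args, R') \<in> erules ?E" for args R'
  proof -
    obtain c where c: "c \<in> set cs" and ar: "args = App (Con c) (map Var [0..<ar c]) # map Var [ar c..<ar c + l]" "R' = B c"
      using mem by (auto simp: erules_def)
    have ev: "map (eval P \<sigma>) args = T c (map \<sigma> [0..<ar c]) # map \<sigma> [ar c..<ar c + l]" for \<sigma>
      unfolding ar(1) by (simp add: comp_def)
    have vs: "(\<exists>t\<in>set args. Var x \<in> subt t) \<longleftrightarrow> x < ar c + l" for x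
      by (auto simp: ar(1))
    have "sem ?E (take (nn ?E) (map (eval P \<sigma>) args)) (drop (nn ?E) (map (eval P \<sigma>) args)) = eval P \<sigma> R'"
      if "\<forall>x. \<forall>t\<in>set args. Var x \<in> subt t \<longrightarrow> gterm_ok cs ar (\<sigma> x)" for \<sigma>
      using that sem[OF c, of \<sigma>] vs unfolding ev ar(2) by auto
    moreover have "length args = nn ?E + ns ?E" by (simp add: ar)
    moreover have "\<forall>t\<in>set args. wft (sigof P) t \<and> (\<forall>a ts. App a ts \<in> subt t \<longrightarrow> a \<in> Con ` set cs)"
      using c by (auto simp: ar)
    ultimately show ?thesis
      unfolding new_rule_ok_def vs using R[OF c] vars[OF c] pt[OF c] unfolding ar by auto
  qed
  ultimately show ?thesis
    using add_entry[OF good, of ?E] by (auto simp: shape_ok_def)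
qed

lemma eval_emb: "eval P \<sigma> (emb t) = t"
  by (induction t) (auto intro: map_idI)

lemma wft_emb: "gterm_ok cs ar t \<Longrightarrow> wft (sigof P) (emb t)"
  by (induction t) auto

lemma subt_emb_symbol:
  "gterm_ok cs ar t \<Longrightarrow> App a ts \<in> subt (emb t) \<Longrightarrow> a \<in> Con ` set cs"
  by (induction t) auto

lemma no_Var_emb: "Var x \<notin> subt (emb t)"
  by (induction t) auto

lemma Var_unfolding_tm: "Var x \<in> subt (unfolding_tm h m t) \<Longrightarrow> x < m"
  by (induction t) (auto simp: no_Var_emb)

lemma add_Recur:
  assumes good: "good P" and h: "\<And>c. c \<in> set cs \<Longrightarrow> realizes P (ar c + k) (l + ar c) (hf c) (h c)"
    and f: "\<And>c xs ys zs. c \<in> set cs \<Longrightarrow> vargs cs ar (ar c) xs \<Longrightarrow> vargs cs ar k ys \<Longrightarrow> vargs cs ar l zs \<Longrightarrow>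
      f (T c xs # ys) zs = hf c (xs @ ys) (zs @ map (\<lambda>x. f (x # ys) zs) xs)"
  shows "\<exists>Q i. good (P @ Q) \<and> realizes (P @ Q) (Suc k) l f i"
proof -
  let ?E = "Entry (Suc k) l f (Recur h)"
  let ?U = "unfolding_tm h (k + l)"
  have split: "map g [0..<k + l] = map g [0..<k] @ map g [k..<k + l]" for g :: "nat \<Rightarrow> 'b"
    by (simp add: upt_add_eq_append[of 0 k l, simplified])
  have hP: "h c < length P" "nn (P ! h c) = ar c + k" "ns (P ! h c) = l + ar c" "sem (P ! h c) = hf c"
    if "c \<in> set cs" for c
    using h[OF that] by (auto simp: realizes_def)
  have wfU: "wft (sigof P) (?U t)" if "gterm_ok cs ar t" for t
    using that
  proof (induction t)
    case (T c ts)
    then show ?case using hP[of c] by (auto simp: wft_emb)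
  qed
  \<comment> \<open>Semantic soundness of the one-step unfolding: structural induction on the
    recursion argument, with the recursion equation used once at each level.\<close>
  have ev: "eval P \<sigma> (?U t) = f (t # map \<sigma> [0..<k]) (map \<sigma> [k..<k + l])"
    if "gterm_ok cs ar t" and \<sigma>: "\<And>x. x < k + l \<Longrightarrow> gterm_ok cs ar (\<sigma> x)" for t \<sigma>
    using that(1)
  proof (induction t)
    case (T c ts)
    then have c: "c \<in> set cs" "length ts = ar c" "vargs cs ar (ar c) ts" by (auto simp: vargs_def)
    have "vargs cs ar k (map \<sigma> [0..<k])" "vargs cs ar l (map \<sigma> [k..<k + l])"
      using \<sigma> by (auto simp: vargs_def)
    note f = f[OF c(1,3) this]
    have 1: "map (eval P \<sigma>) (map ?U ts) = map (\<lambda>x. f (x # map \<sigma> [0..<k]) (map \<sigma> [k..<k + l])) ts"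
      using T by auto
    have 2: "map (eval P \<sigma>) (map emb ts) = ts" by (simp add: eval_emb map_idI)
    have 3: "map (eval P \<sigma>) (map Var [0..<k + l]) = map \<sigma> [0..<k] @ map \<sigma> [k..<k + l]"
      using split[of \<sigma>] by (simp add: comp_def)
    have "eval P \<sigma> (?U (T c ts)) = ap P (Fn (h c)) (map (eval P \<sigma>) (map emb ts) @
        map (eval P \<sigma>) (map Var [0..<k + l]) @ map (eval P \<sigma>) (map ?U ts))"
      by (simp only: unfolding_tm.simps eval.simps map_append)
    also have "\<dots> = hf c (ts @ map \<sigma> [0..<k]) (map \<sigma> [k..<k + l] @
        map (\<lambda>x. f (x # map \<sigma> [0..<k]) (map \<sigma> [k..<k + l])) ts)"
      unfolding 1 2 3 using hP[OF c(1)] c(2) by simp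
    finally show ?case using f by simp
  qed
  have "total ?E"
    unfolding total_def
  proof (intro allI impI)
    fix xs zs assume "vargs cs ar (nn ?E) xs \<and> vargs cs ar (ns ?E) zs"
    then have v: "vargs cs ar (Suc k) xs" "vargs cs ar l zs" by auto
    then obtain t ys where xs: "xs = t # ys" by (cases xs) (auto simp: vargs_def)
    let ?\<sigma> = "\<lambda>x. (ys @ zs) ! x"
    have t: "gterm_ok cs ar t" "length ys = k" "length zs = l" using v xs by (auto simp: vargs_def)
    have ok: "gterm_ok cs ar (?\<sigma> x)" if "x < k + l" for x
      using v xs t that nth_mem[of x "ys @ zs"] by (auto simp: vargs_def)
    have "map ?\<sigma> [0..<k] = ys" "map ?\<sigma> [k..<k + l] = zs"
      using t by (auto simp: nth_append intro!: nth_equalityI)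
    then have "f xs zs = eval P ?\<sigma> (?U t)" using ev[OF t(1), of ?\<sigma>] ok xs by simp
    moreover have "gterm_ok cs ar (eval P ?\<sigma> (?U t))"
      by (intro good_eval_ok[OF good wfU[OF t(1)]] ok) (rule Var_unfolding_tm)
    ultimately show "gterm_ok cs ar (sem ?E xs zs)" by simp
  qed
  moreover have "shape_ok P ?E" using hP by (simp add: shape_ok_def)
  moreover have "new_rule_ok P ?E args R" if mem: "(args, R) \<in> erules ?E" for args R
  proof -
    obtain t where t: "gterm_ok cs ar t" and ar: "args = emb t # map Var [0..<k + l]" "R = ?U t"
      using mem by (auto simp: erules_def)
    have take: "take (Suc k) args = emb t # map Var [0..<k]"
      by (simp add: ar take_map take_upt)
    \<comment> \<open>Generalized from \<open>t\<close> to its subterms \<open>s\<close>, because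
      the arguments of inner step functions are compared with the fixed argument
      \<open>emb t\<close> of the left-hand side.\<close>
    have pt: "pt_tm (sigof P) (Suc k) args (?U s)" if "emb s \<in> subt (emb t)" "gterm_ok cs ar s" for s
      using that
    proof (induction s)
      case (T c ts)
      then have c: "c \<in> set cs" "length ts = ar c" by auto
      \<comment> \<open>Regrouped at the border of \<open>h c\<close>: the first
        \<open>ar c + k\<close> entries are its normal arguments.\<close>
      have args: "map emb ts @ map Var [0..<k + l] @ map ?U ts = (map emb ts @ map Var [0..<k]) @ (map Var [k..<k + l] @ map ?U ts)"
        using split[of Var] by simp
      have len: "length (map emb ts @ map Var [0..<k]) = snn (sigof P) (Fn (h c))" using hP[OF c(1)] c(2) by simp
      have sub: "emb u \<in> subt (emb t)" if "u \<in> set ts" for u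
      proof -
        have "emb u \<in> subt (emb (T c ts))" using that arg_subt[of "emb u" "map emb ts" "Con c"] by simp
        then show ?thesis using subt_trans[OF T.prems(1)] by blast
      qed
      show ?case
        unfolding unfolding_tm.simps args
      proof (rule pt_app)
        show "\<forall>u\<in>set (take (snn (sigof P) (Fn (h c))) ((map emb ts @ map Var [0..<k]) @ (map Var [k..<k + l] @ map ?U ts))).
            \<exists>s\<in>set (take (Suc k) args). u \<in> subt s"
          unfolding len[symmetric] append_eq_conv_conj take using sub by auto
        show "\<forall>u\<in>set (drop (snn (sigof P) (Fn (h c))) ((map emb ts @ map Var [0..<k]) @ (map Var [k..<k + l] @ map ?U ts))).
            pt_tm (sigof P) (Suc k) args u"
          unfolding len[symmetric] append_eq_conv_conj
          using T.IH T.prems sub by (auto simp: ar intro: pt_arg)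
      qed
    qed
    have ev': "map (eval P \<sigma>) args = (t # map \<sigma> [0..<k]) @ map \<sigma> [k..<k + l]" for \<sigma>
      using split[of \<sigma>] by (simp add: ar eval_emb comp_def)
    have "sem ?E (take (nn ?E) (map (eval P \<sigma>) args)) (drop (nn ?E) (map (eval P \<sigma>) args)) = eval P \<sigma> R"
      if "\<forall>x. \<forall>t\<in>set args. Var x \<in> subt t \<longrightarrow> gterm_ok cs ar (\<sigma> x)" for \<sigma>
    proof -
      have "gterm_ok cs ar (\<sigma> x)" if "x < k + l" for x
        using that \<open>\<forall>x. \<forall>t\<in>set args. Var x \<in> subt t \<longrightarrow> gterm_ok cs ar (\<sigma> x)\<close> by (auto simp: ar)
      then show ?thesis unfolding ev' ar(2) using ev[OF t, of \<sigma>] by simp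
    qed
    moreover have "length args = nn ?E + ns ?E" by (simp add: ar)
    moreover have "\<forall>t\<in>set args. wft (sigof P) t \<and> (\<forall>a ts. App a ts \<in> subt t \<longrightarrow> a \<in> Con ` set cs)"
      using t wft_emb subt_emb_symbol by (auto simp: ar)
    moreover have "\<exists>t\<in>set args. Var x \<in> subt t" if "Var x \<in> subt R" for x
      using Var_unfolding_tm that by (auto simp: ar)
    ultimately show ?thesis
      unfolding new_rule_ok_def using wfU[OF t] pt[OF subt_refl t] unfolding ar(2) by auto
  qed
  ultimately show ?thesis
    using add_entry[OF good, of ?E] by auto
qed

lemma cs_index: "\<exists>idx. \<forall>c\<in>set cs. idx c < length cs \<and> cs ! idx c = c"
  by (rule bchoice) (auto simp: in_set_conv_nth)

lemma gsr_realizable: "gsr cs ar k l f \<Longrightarrow> realizable k l f"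
proof (induction rule: gsr.induct)
  case (const j k l f)
  show ?case
    unfolding realizable_def
  proof (intro allI impI)
    fix P assume P: "good P"
    show "\<exists>Q i. good (P @ Q) \<and> realizes (P @ Q) k l f i"
      by (rule add_Expl[OF P, of "App (Con (cs ! j)) []"])
        (use const in \<open>auto simp: vargs_def intro!: pt_app\<close>)
  qed
next
  case (cons j f)
  show ?case
    unfolding realizable_def
  proof (intro allI impI)
    fix P assume P: "good P"
    show "\<exists>Q i. good (P @ Q) \<and> realizes (P @ Q) 0 (ar (cs ! j)) f i"
    proof (rule add_Expl[OF P, of "App (Con (cs ! j)) (map Var [0..<ar (cs ! j)])"])
      show "pt_tm (sigof P) 0 (map Var [0..<0 + ar (cs ! j)]) (App (Con (cs ! j)) (map Var [0..<ar (cs ! j)]))"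
        by (rule pt_app) (auto intro: pt_arg)
    qed (use cons in \<open>auto simp: vargs_def comp_def\<close>)
  qed
next
  case (proj j k l f)
  show ?case
    unfolding realizable_def
  proof (intro allI impI)
    fix P assume P: "good P"
    show "\<exists>Q i. good (P @ Q) \<and> realizes (P @ Q) k l f i"
    proof (rule add_Expl[OF P, of "Var j"])
      fix \<sigma> :: "nat \<Rightarrow> 'c gterm" assume "\<And>x. x < k + l \<Longrightarrow> gterm_ok cs ar (\<sigma> x)"
      then have "f (map \<sigma> [0..<k]) (map \<sigma> [k..<k + l]) = (map \<sigma> [0..<k] @ map \<sigma> [k..<k + l]) ! j"
        using proj by (auto simp: vargs_def)
      then show "f (map \<sigma> [0..<k]) (map \<sigma> [k..<k + l]) = eval P \<sigma> (Var j)"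
        using proj(1) by (auto simp: nth_append)
    qed (use proj(1) in \<open>auto intro!: pt_arg\<close>)
  qed
next
  case (pred i j f)
  show ?case
    unfolding realizable_def
  proof (intro allI impI)
    fix P assume P: "good P"
    \<comment> \<open>For \<open>j = 0\<close> and for other constructors the predecessor returns
      its argument, so the right-hand side is the pattern itself, a subterm of the left-hand
      side.\<close>
    define B where "B c = (if c = cs ! i \<and> j \<noteq> 0 then Var (j - 1) else App (Con c) (map Var [0..<ar c]))" for c
    have "\<exists>Q i. good (P @ Q) \<and> realizes (P @ Q) 0 (Suc 0) f i"
    proof (rule add_Cases[OF P, of B])
      fix c assume c: "c \<in> set cs"
      show "wft (sigof P) (B c)" using c by (auto simp: B_def)
      show "x < ar c + 0" if "Var x \<in> subt (B c)" for x
        using that pred(2) by (auto simp: B_def split: if_splits)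
      \<comment> \<open>The selected variable lies one level inside the pattern; this is the case
        for which \<open>pt_var\<close> exists.\<close>
      have "Var (j - 1) \<in> subt (App (Con c) (map Var [0..<ar c]))" if "c = cs ! i" "j \<noteq> 0"
        using pred(2) that by auto
      then show "pt_tm (sigof P) 0 (App (Con c) (map Var [0..<ar c]) # map Var [ar c..<ar c + 0]) (B c)"
        unfolding B_def by (auto simp del: subt.simps intro: pt_arg pt_var)
      fix \<sigma> :: "nat \<Rightarrow> 'c gterm" assume "\<And>x. x < ar c + 0 \<Longrightarrow> gterm_ok cs ar (\<sigma> x)"
      then have "gterm_ok cs ar (T c (map \<sigma> [0..<ar c]))" using c by auto
      then have "f [] [T c (map \<sigma> [0..<ar c])] =
          (if c = cs ! i \<and> j \<noteq> 0 then map \<sigma> [0..<ar c] ! (j - 1) else T c (map \<sigma> [0..<ar c]))"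
        using pred(3,4) by (cases "c = cs ! i") (auto simp del: gterm_ok.simps)
      then show "f [] (T c (map \<sigma> [0..<ar c]) # map \<sigma> [ar c..<ar c + 0]) = eval P \<sigma> (B c)"
        using pred(2) by (auto simp: B_def comp_def)
    qed
    then show "\<exists>Q i. good (P @ Q) \<and> realizes (P @ Q) 0 1 f i" by simp
  qed
next
  case (cond f)
  obtain idx where "\<forall>c\<in>set cs. idx c < length cs \<and> cs ! idx c = c"
    using cs_index by blast
  note idx = bspec[OF this]
  show ?case
    unfolding realizable_def
  proof (intro allI impI)
    fix P assume P: "good P"
    show "\<exists>Q i. good (P @ Q) \<and> realizes (P @ Q) 0 (Suc (length cs)) f i"
    \<comment> \<open>The pattern occupies the variables below \<open>ar c\<close>, so the branch
      for \<open>c\<close> is found after an offset of \<open>ar c\<close>.\<close>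
    proof (rule add_Cases[OF P, of "\<lambda>c. Var (ar c + idx c)"])
      fix c assume c: "c \<in> set cs"
      show "x < ar c + length cs" if "Var x \<in> subt (Var (ar c + idx c))" for x
        using that idx[OF c] by auto
      show "pt_tm (sigof P) 0 (App (Con c) (map Var [0..<ar c]) # map Var [ar c..<ar c + length cs]) (Var (ar c + idx c))"
        using idx[OF c] by (auto intro!: pt_arg)
      fix \<sigma> :: "nat \<Rightarrow> 'c gterm" assume ok: "\<And>x. x < ar c + length cs \<Longrightarrow> gterm_ok cs ar (\<sigma> x)"
      have "f [] (T (cs ! idx c) (map \<sigma> [0..<ar c]) # map \<sigma> [ar c..<ar c + length cs]) = map \<sigma> [ar c..<ar c + length cs] ! idx c"
      proof -
        have "gterm_ok cs ar (T (cs ! idx c) (map \<sigma> [0..<ar c]))" "vargs cs ar (length cs) (map \<sigma> [ar c..<ar c + length cs])"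
          using idx[OF c] ok c by (auto simp: vargs_def)
        then show ?thesis using cond idx[OF c] by blast
      qed
      then show "f [] (T c (map \<sigma> [0..<ar c]) # map \<sigma> [ar c..<ar c + length cs]) = eval P \<sigma> (Var (ar c + idx c))"
        using idx[OF c] by simp
    qed simp
  qed
next
  case (comp js gs h k l f)
  show ?case
    unfolding realizable_def
  proof (intro allI impI)
    fix P0 assume P0: "good P0"
    let ?Fs = "(length js, length gs, h) # map (\<lambda>g. (k, l, g)) gs"
    obtain Q "is" where Q: "good (P0 @ Q)" "list_all2 (\<lambda>(k, l, f) i. realizes (P0 @ Q) k l f i) ?Fs is"
      using realize_list[of ?Fs, OF _ P0] comp.IH by auto
    define P where "P = P0 @ Q"
    note P = Q(1)[folded P_def]
    obtain ih "ig" where ih: "realizes P (length js) (length gs) h ih"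
      and ig: "list_all2 (\<lambda>g i. realizes P k l g i) gs ig"
      using Q(2) by (auto simp: P_def list_all2_Cons1 list_all2_map1)
    define A :: "'c sym tm list" where "A = map Var [0..<k + l]"
    \<comment> \<open>Each inner function gets the full argument list \<open>A\<close>, whose border
      agrees with that of \<open>f\<close>. The normal arguments of the outer function are variables
      with index below \<open>k\<close>, hence normal on the left; the inner calls stand at its safe
      positions.\<close>
    define R where "R = App (Fn ih) (map Var js @ map (\<lambda>i. App (Fn i) A) ig)"
    have len: "length ig = length gs" using ig by (simp add: list_all2_lengthD)
    have igP: "i < length P" "nn (P ! i) = k" "ns (P ! i) = l" if "i \<in> set ig" for i
      using that ig by (auto simp: list_all2_conv_all_nth realizes_def in_set_conv_nth)
    have ihP: "ih < length P" "nn (P ! ih) = length js" "ns (P ! ih) = length gs" "sem (P ! ih) = h"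
      using ih by (auto simp: realizes_def)
    have takeA: "take k A = map Var [0..<k]"
      by (simp add: A_def take_map take_upt)
    have dropA: "drop k A = map Var [k..<k + l]"
      by (simp add: A_def drop_map drop_upt)
    have "\<exists>Q' i. good (P @ Q') \<and> realizes (P @ Q') k l f i"
    proof (rule add_Expl[OF P, of R])
      show "wft (sigof P) R"
        using ihP igP len by (auto simp: R_def A_def)
      show "x < k + l" if "Var x \<in> subt R" for x
        using that comp.hyps by (auto simp: R_def A_def)
      have "pt_tm (sigof P) k A (App (Fn i) A)" if i: "i \<in> set ig" for i
      proof (rule pt_app)
        show "\<forall>t\<in>set (take (snn (sigof P) (Fn i)) A). \<exists>s\<in>set (take k A). t \<in> subt s"
          using igP[OF i] subt_refl by fastforce
        show "\<forall>t\<in>set (drop (snn (sigof P) (Fn i)) A). pt_tm (sigof P) k A t"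
          by (auto dest: in_set_dropD intro: pt_arg)
      qed
      then show "pt_tm (sigof P) k (map Var [0..<k + l]) R"
        unfolding A_def[symmetric] R_def
        by (intro pt_app) (use ihP comp.hyps in \<open>auto simp: takeA\<close>)
      fix \<sigma> :: "nat \<Rightarrow> 'c gterm" assume ok: "\<And>x. x < k + l \<Longrightarrow> gterm_ok cs ar (\<sigma> x)"
      let ?xs = "map \<sigma> [0..<k]" let ?ys = "map \<sigma> [k..<k + l]"
      have "vargs cs ar k ?xs" "vargs cs ar l ?ys" using ok by (auto simp: vargs_def)
      then have f: "f ?xs ?ys = h (map (\<lambda>j. ?xs ! j) js) (map (\<lambda>g. g ?xs ?ys) gs)"
        using comp.hyps by blast
      have 1: "map (\<lambda>j. ?xs ! j) js = map (eval P \<sigma>) (map Var js)"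
        using comp.hyps by auto
      have evA: "map (eval P \<sigma>) A = ?xs @ ?ys"
        by (simp add: A_def comp_def upt_add_eq_append[of 0 k l, simplified])
      have "eval P \<sigma> (App (Fn i) A) = sem (P ! i) ?xs ?ys" if "i \<in> set ig" for i
        using igP[OF that] by (simp add: evA)
      moreover have "sem (P ! (ig ! n)) = gs ! n" if "n < length gs" for n
        using ig that by (auto simp: list_all2_conv_all_nth realizes_def)
      ultimately have 2: "map (\<lambda>g. g ?xs ?ys) gs = map (eval P \<sigma>) (map (\<lambda>i. App (Fn i) A) ig)"
        using len by (intro nth_equalityI) (simp_all del: eval.simps)
      show "f ?xs ?ys = eval P \<sigma> R"
        unfolding f 1 2 using ihP by (simp add: R_def del: map_map)
    qed
    then show "\<exists>Q i. good (P0 @ Q) \<and> realizes (P0 @ Q) k l f i"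
      unfolding P_def append_assoc by blast
  qed
next
  case (recur hs k l f)
  obtain idx where "\<forall>c\<in>set cs. idx c < length cs \<and> cs ! idx c = c"
    using cs_index by blast
  note idx = bspec[OF this]
  show ?case
    unfolding realizable_def
  proof (intro allI impI)
    fix P0 assume P0: "good P0"
    let ?Fs = "map (\<lambda>j. (ar (cs ! j) + k, l + ar (cs ! j), hs ! j)) [0..<length cs]"
    obtain Q "is" where Q: "good (P0 @ Q)" "list_all2 (\<lambda>(k, l, f) i. realizes (P0 @ Q) k l f i) ?Fs is"
      using realize_list[of ?Fs, OF _ P0] recur.IH by auto
    have "\<exists>Q' i. good ((P0 @ Q) @ Q') \<and> realizes ((P0 @ Q) @ Q') (Suc k) l f i"
    \<comment> \<open>The step functions are listed by position in \<open>cs\<close> while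
      \<open>Recur\<close> is indexed by constructors; \<open>idx\<close> translates.\<close>
    proof (rule add_Recur[OF Q(1), where h = "\<lambda>c. is ! idx c" and hf = "\<lambda>c. hs ! idx c"])
      fix c assume c: "c \<in> set cs"
      show "realizes (P0 @ Q) (ar c + k) (l + ar c) (hs ! idx c) (is ! idx c)"
        using Q(2) idx[OF c] by (auto simp: list_all2_conv_all_nth)
      fix xs ys zs
      assume "vargs cs ar (ar c) xs" "vargs cs ar k ys" "vargs cs ar l zs"
      then show "f (T c xs # ys) zs = (hs ! idx c) (xs @ ys) (zs @ map (\<lambda>x. f (x # ys) zs) xs)"
        using recur.hyps idx[OF c] by metis
    qed
    then show "\<exists>Q i. good (P0 @ Q) \<and> realizes (P0 @ Q) (Suc k) l f i"
      unfolding append_assoc by blast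
  qed
qed

end

theorem mainTheorem9:
  fixes cs :: "'c list" and ar :: "'c \<Rightarrow> nat" and k l :: nat
    and f :: "'c gterm list \<Rightarrow> 'c gterm list \<Rightarrow> 'c gterm"
  assumes "distinct cs"
    and "\<exists>c\<in>set cs. ar c = 0"
    and "gsr cs ar k l f"
  shows "\<exists>S Gs d. cons S = cs \<and> car S = ar \<and> sig_ok S
     \<and> constructor_grs S Gs \<and> computes S Gs k l f \<and> pt_sep S Gs
     \<and> (\<forall>g\<in>Fsyms S. sar S g \<le> d)
     \<and> (\<forall>R\<in>Gfin Gs. gsize (rhsG R) \<le> d)
     \<and> (\<forall>R\<in>Ginf Gs. inf_rule_conds S d R)"
proof -
  interpret constructors cs ar .
  have "good []" by (simp add: good_def)
  then obtain P i where P: "good P" and i: "realizes P k l f i"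
    using gsr_realizable[OF assms(3)] unfolding realizable_def by (metis append_Nil)
  have "computes (sigof P) (grs P) k l f"
    using grs_computes[OF P, of i] i by (auto simp: realizes_def)
  moreover have "sig_ok (sigof P)" by (simp add: sig_ok_def)
  ultimately show ?thesis
    using constructor_grs_grs[OF P] pt_sep_grs[OF P] grs_bounds[OF P]
    by (intro exI[of _ "sigof P"] exI[of _ "grs P"]) auto
qed

end
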